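(* For every integer $n\geq 2$ there exists a constant $C$, and for all $a,b\geq 0$ there exists $\mu(a,b)>0$, such that the following holds. Let $\mathbb{H}^n=\{(x_0,\bar x): x_0\in[0,\infty),\ \bar x\in\mathbb{R}^{n-1}\}$ with the Euclidean metric, let $y\in\mathbb{H}^n$, $r>0$, and $D_r(y):=B_r(y)\cap\mathbb{H}^n$, where $B_r(y)$ is the Euclidean open ball of radius $r$ centered at $y$. Suppose that $e\in C^2(D_r(y),[0,\infty))$ satisfies, for some constants $A_0,A_1,B_0,B_1\geq 0$, $$\Delta e \leq A_0 + A_1 e + a\, e^{\frac{n+2}{n}} \ \text{ on } D_r(y), \qquad \frac{\partial}{\partial\nu}\Big|_{\partial\mathbb{H}^n} e \leq B_0 + B_1 e + b\, e^{\frac{n+1}{n}} \ \text{ on } D_r(y)\cap\partial\mathbb{H}^n,$$ and $$\int_{D_r(y)} e \leq \mu(a,b).$$ Then $$e(y) \leq C A_0 r^2 + C B_0 r + C\bigl(A_1^{\frac n2} + B_1^n + r^{-n}\bigr)\int_{D_r(y)} e.$$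
   Context: $\Delta = -\sum_{k}\partial_{x_k}^2$ is the positive definite Euclidean Laplacian, and the outer normal derivative on $\partial\mathbb{H}^n=\{x_0=0\}$ is $\frac{\partial}{\partial\nu} = -\frac{\partial}{\partial x_0}\big|_{x_0=0}$. *)

theory Defs
  imports "HOL-Analysis.Analysis"
begin

text \<open>Points of R^n are written as pairs (x0, xbar) with xbar in R^(n-1) = real^'m,
  so n = CARD('m) + 1 >= 2. The product norm is the Euclidean norm.\<close>

definition halfspace :: "(real \<times> (real^'m)) set" where
  "halfspace = {x. fst x \<ge> 0}"

definition halfball :: "real \<times> (real^'m) \<Rightarrow> real \<Rightarrow> (real \<times> (real^'m)) set" where
  "halfball y r = ball y r \<inter> halfspace"

definition C2_with_derivs ::
  "'a::euclidean_space set \<Rightarrow> ('a \<Rightarrow> real) \<Rightarrow> ('a \<Rightarrow> 'a \<Rightarrow>\<^sub>L real)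
     \<Rightarrow> ('a \<Rightarrow> 'a \<Rightarrow>\<^sub>L 'a \<Rightarrow>\<^sub>L real) \<Rightarrow> bool" where
  "C2_with_derivs S e De D2e \<longleftrightarrow>
     (\<forall>x\<in>S. (e has_derivative blinfun_apply (De x)) (at x within S)) \<and>
     (\<forall>x\<in>S. (De has_derivative blinfun_apply (D2e x)) (at x within S)) \<and>
     continuous_on S D2e"

definition pos_laplacian :: "('a::euclidean_space \<Rightarrow> 'a \<Rightarrow>\<^sub>L 'a \<Rightarrow>\<^sub>L real) \<Rightarrow> 'a \<Rightarrow> real" where
  "pos_laplacian D2e x = - (\<Sum>b\<in>Basis. blinfun_apply (blinfun_apply (D2e x) b) b)"

definition outer_normal_deriv :: "(real \<times> (real^'m) \<Rightarrow> (real \<times> (real^'m)) \<Rightarrow>\<^sub>L real) \<Rightarrow> real \<times> (real^'m) \<Rightarrow> real" where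
  "outer_normal_deriv De x = - blinfun_apply (De x) (1, 0)"

end

theory Submission
  imports Defs
begin

text \<open>
  If \<open>\<Delta> e \<le> A\<close> and \<open>\<partial>e/\<partial>\<nu> \<le> B\<close> with constants \<open>A\<close> and \<open>B\<close>, then
  \<open>e + A/2 (x\<^sub>0 - c)\<^sup>2 + B (x\<^sub>0 - c)\<close>, reflected evenly across the boundary, is subharmonic: the kink
  at \<open>x\<^sub>0 = 0\<close> is convex. Subharmonicity is used only through symmetric second differences, which can be
  moved onto a test function by translation invariance of Lebesgue measure. With
  \<open>u = max 0 (s\<^sup>2 - |x - z|\<^sup>2)\<close>, the \<open>s\<close>-derivative of the averaging kernel
  \<open>u\<^sup>2 / s\<^bsup>n+4\<^esup>\<close> is a positive multiple of the trace of the Hessian of \<open>u\<^sup>3\<close>, so averages of a subharmonic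
  function against this kernel increase with \<open>s\<close>. This gives a mean value inequality for \<open>e\<close>.

  The nonlinear bound follows by the Heinz trick: at a maximum point \<open>z\<close> of
  \<open>(r/2 - |x - y|)\<^sup>n e(x)\<close> one has \<open>e \<le> 2\<^sup>n e(z)\<close> on a half-ball of radius
  \<open>\<sigma> = (r/2 - |z - y|)/2\<close> around \<open>z\<close>. Applied there on a radius \<open>\<rho> \<le> \<sigma>\<close> small in terms of
  \<open>A1\<close>, \<open>B1\<close> and \<open>e(z)\<close>, the mean value inequality absorbs all terms that involve \<open>e(z)\<close>; the choice of \<open>\<rho>\<close>
  itself contributes a term \<open>e(z) \<integral>e\<close>, which is absorbed because \<open>\<integral>e\<close> is small.
\<close>

section \<open>Derivatives of truncated powers and tools for Lebesgue integrals\<close>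

text \<open>The positive part has a kink at 0, but its square is differentiable there because the
  difference quotient is bounded by \<open>|h|\<close>. With the cube treated next, this makes
  \<open>bump z s x ^ 3\<close> twice differentiable along lines.\<close>

lemma max0_square_deriv:
  "((\<lambda>u::real. (max 0 u)\<^sup>2) has_real_derivative 2 * max 0 u) (at u)"
proof -
  consider "u < 0" | "u = 0" | "u > 0" by linarith
  then show ?thesis
  proof cases
    case 1
    have "((\<lambda>u::real. 0) has_real_derivative 2 * max 0 u) (at u)"
      using 1 by (auto intro!: derivative_eq_intros)
    then show ?thesis
      by (rule has_field_derivative_transform_within_open[of _ _ _ "{..<0}"]) (use 1 in auto)
  next
    case 2
    have "((\<lambda>h::real. \<bar>h\<bar>) \<longlongrightarrow> 0) (at 0)"
      by (rule tendsto_eq_intros | simp)+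
    then have "((\<lambda>h::real. (max 0 h)\<^sup>2 / h) \<longlongrightarrow> 0) (at 0)"
      by (rule Lim_null_comparison[rotated])
         (auto simp: max_def power2_eq_square intro!: always_eventually)
    then show ?thesis using 2 by (simp add: DERIV_def)
  next
    case 3
    have "((\<lambda>u::real. u\<^sup>2) has_real_derivative 2 * max 0 u) (at u)"
      using 3 by (auto intro!: derivative_eq_intros)
    then show ?thesis
      by (rule has_field_derivative_transform_within_open[of _ _ _ "{0<..}"]) (use 3 in auto)
  qed
qed

lemma max0_cube_deriv:
  "((\<lambda>u::real. (max 0 u)^3) has_real_derivative 3 * (max 0 u)\<^sup>2) (at u)"
proof -
  have "(\<lambda>u::real. (max 0 u)^3) = (\<lambda>u. (max 0 u)\<^sup>2 * u)"
    by (auto simp: max_def power2_eq_square power3_eq_cube)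
  moreover have "((\<lambda>u::real. (max 0 u)\<^sup>2 * u) has_real_derivative 2 * max 0 u * u + 1 * (max 0 u)\<^sup>2) (at u)"
    by (rule DERIV_mult'[THEN DERIV_cong] max0_square_deriv DERIV_ident | simp)+
  moreover have "2 * max 0 u * u + 1 * (max 0 u)\<^sup>2 = 3 * (max 0 u)\<^sup>2"
    by (auto simp: max_def power2_eq_square)
  ultimately show ?thesis by metis
qed

lemma integrable_continuous_compact_support:
  fixes f :: "'a::euclidean_space \<Rightarrow> real"
  assumes "continuous_on UNIV f" "compact K" "\<And>x. x \<notin> K \<Longrightarrow> f x = 0"
  shows "integrable lborel f"
proof -
  have "integrable lborel (\<lambda>x. indicator K x *\<^sub>R f x)"
    by (rule borel_integrable_compact) (use assms continuous_on_subset[OF assms(1)] in auto)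
  moreover have "(\<lambda>x. indicator K x *\<^sub>R f x) = f"
    using assms(3) by (force simp: indicator_def)
  ultimately show ?thesis by simp
qed

lemma lborel_integral_translate:
  fixes f :: "'a::euclidean_space \<Rightarrow> real"
  assumes [measurable]: "f \<in> borel_measurable borel"
  shows "(\<integral>x. f (c + x) \<partial>lborel) = (\<integral>x. f x \<partial>lborel)"
proof -
  have "(\<integral>x. f x \<partial>lborel) = (\<integral>x. f x \<partial>(distr lborel borel ((+) c)))"
    by (simp add: lborel_distr_plus)
  also have "\<dots> = (\<integral>x. f (c + x) \<partial>lborel)"
    by (rule integral_distr) auto
  finally show ?thesis by simp
qed

section \<open>Symmetric second differences\<close>

text \<open>Subtracting \<open>m * \<tau>\<^sup>2 / 2\<close> reduces the claim to a function with
  nondecreasing derivative, for which the mean slope to the right of \<open>x\<close> dominates the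
  one to the left. Derivatives are taken within the closed interval, so that a segment may end on
  the boundary of the half-space.\<close>

lemma second_difference_ge:
  fixes g g1 g2 :: "real \<Rightarrow> real"
  assumes "0 < t"
    and g1: "\<And>\<tau>. \<tau> \<in> {x-t..x+t} \<Longrightarrow> (g has_real_derivative g1 \<tau>) (at \<tau> within {x-t..x+t})"
    and g2: "\<And>\<tau>. \<tau> \<in> {x-t..x+t} \<Longrightarrow> (g1 has_real_derivative g2 \<tau>) (at \<tau> within {x-t..x+t})"
    and m: "\<And>\<tau>. \<tau> \<in> {x-t..x+t} \<Longrightarrow> g2 \<tau> \<ge> m"
  shows "g (x+t) + g (x-t) - 2 * g x \<ge> m * t\<^sup>2"
proof -
  define h where "h = (\<lambda>\<tau>. g \<tau> - m * \<tau>\<^sup>2 / 2)"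
  define h1 where "h1 = (\<lambda>\<tau>. g1 \<tau> - m * \<tau>)"
  have h: "(h has_real_derivative h1 \<tau>) (at \<tau> within S)" if "\<tau> \<in> {x-t..x+t}" "S \<subseteq> {x-t..x+t}" for \<tau> S
    unfolding h_def h1_def
    by (rule derivative_eq_intros DERIV_subset[OF g1 that(2)] that | simp)+
  have h1: "(h1 has_real_derivative g2 \<tau> - m) (at \<tau> within S)" if "\<tau> \<in> {x-t..x+t}" "S \<subseteq> {x-t..x+t}" for \<tau> S
    unfolding h1_def
    by (rule derivative_eq_intros DERIV_subset[OF g2 that(2)] that | simp)+
  have mono: "h1 u \<le> h1 v" if "x - t \<le> u" "u < v" "v \<le> x + t" for u v
  proof -
    have "\<exists>\<xi>\<in>{u<..<v}. h1 v - h1 u = (g2 \<xi> - m) * (v - u)"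
      by (rule mvt_simple[OF that(2), of h1 "\<lambda>\<xi> d. (g2 \<xi> - m) * d"])
         (use h1 that in \<open>auto simp: has_field_derivative_def\<close>)
    then obtain \<xi> where "\<xi> \<in> {u<..<v}" "h1 v - h1 u = (g2 \<xi> - m) * (v - u)" by blast
    moreover from this have "(g2 \<xi> - m) * (v - u) \<ge> 0" using m[of \<xi>] that by auto
    ultimately show ?thesis by linarith
  qed
  have "\<exists>\<xi>\<in>{x<..<x+t}. h (x+t) - h x = h1 \<xi> * (x + t - x)"
    by (rule mvt_simple[of _ _ h "\<lambda>\<xi> d. h1 \<xi> * d"])
       (use h assms(1) in \<open>auto simp: has_field_derivative_def\<close>)
  then obtain \<xi> where \<xi>: "\<xi> \<in> {x<..<x+t}" "h (x+t) - h x = h1 \<xi> * t" by auto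
  have "\<exists>\<xi>\<in>{x-t<..<x}. h x - h (x-t) = h1 \<xi> * (x - (x - t))"
    by (rule mvt_simple[of _ _ h "\<lambda>\<xi> d. h1 \<xi> * d"])
       (use h assms(1) in \<open>auto simp: has_field_derivative_def\<close>)
  then obtain \<zeta> where \<zeta>: "\<zeta> \<in> {x-t<..<x}" "h x - h (x-t) = h1 \<zeta> * t" by auto
  have "h1 \<zeta> * t \<le> h1 \<xi> * t"
    by (rule mult_right_mono) (use mono[of \<zeta> \<xi>] \<xi> \<zeta> assms(1) in auto)
  then have "h (x+t) + h (x-t) - 2 * h x \<ge> 0" using \<xi> \<zeta> by linarith
  then show ?thesis unfolding h_def by (simp add: power2_eq_square field_simps)
qed

text \<open>The condition \<open>g1 0 \<ge> 0\<close> makes \<open>\<tau> \<mapsto> g |\<tau>|\<close> convex across \<open>0\<close> up to \<open>m\<close>; as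
  \<open>x < t\<close>, the left-hand side is its second difference at \<open>x\<close>.\<close>

lemma second_difference_even_extension_ge:
  fixes g g1 g2 :: "real \<Rightarrow> real"
  assumes "0 \<le> x" "x < t"
    and g1: "\<And>\<tau>. \<tau> \<in> {0..x+t} \<Longrightarrow> (g has_real_derivative g1 \<tau>) (at \<tau> within {0..x+t})"
    and g2: "\<And>\<tau>. \<tau> \<in> {0..x+t} \<Longrightarrow> (g1 has_real_derivative g2 \<tau>) (at \<tau> within {0..x+t})"
    and m: "\<And>\<tau>. \<tau> \<in> {0..x+t} \<Longrightarrow> g2 \<tau> \<ge> m"
    and 0: "g1 0 \<ge> 0"
  shows "g (x+t) + g (t-x) - 2 * g x \<ge> m * t\<^sup>2"
proof -
  define h where "h = (\<lambda>\<tau>. g \<tau> - m * \<tau>\<^sup>2 / 2)"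
  define h1 where "h1 = (\<lambda>\<tau>. g1 \<tau> - m * \<tau>)"
  have h: "(h has_real_derivative h1 \<tau>) (at \<tau> within S)" if "\<tau> \<in> {0..x+t}" "S \<subseteq> {0..x+t}" for \<tau> S
    unfolding h_def h1_def
    by (rule derivative_eq_intros DERIV_subset[OF g1 that(2)] that | simp)+
  have h1: "(h1 has_real_derivative g2 \<tau> - m) (at \<tau> within S)" if "\<tau> \<in> {0..x+t}" "S \<subseteq> {0..x+t}" for \<tau> S
    unfolding h1_def
    by (rule derivative_eq_intros DERIV_subset[OF g2 that(2)] that | simp)+
  have mono: "h1 u \<le> h1 v" if "0 \<le> u" "u < v" "v \<le> x + t" for u v
  proof -
    have "\<exists>\<xi>\<in>{u<..<v}. h1 v - h1 u = (g2 \<xi> - m) * (v - u)"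
      by (rule mvt_simple[OF that(2), of h1 "\<lambda>\<xi> d. (g2 \<xi> - m) * d"])
         (use h1 that in \<open>auto simp: has_field_derivative_def\<close>)
    then obtain \<xi> where "\<xi> \<in> {u<..<v}" "h1 v - h1 u = (g2 \<xi> - m) * (v - u)" by blast
    moreover from this have "(g2 \<xi> - m) * (v - u) \<ge> 0" using m[of \<xi>] that by auto
    ultimately show ?thesis by linarith
  qed
  \<comment> \<open>The slope starts nonnegative by \<open>g1 0 \<ge> 0\<close> and does not
    decrease, so \<open>h\<close> itself is nondecreasing.\<close>
  have pos: "h1 u \<ge> 0" if "0 \<le> u" "u \<le> x + t" for u
    using mono[of 0 u] 0 that by (cases "u = 0") (auto simp: h1_def)
  have mvt: "\<exists>\<xi>\<in>{u<..<v}. h v - h u = h1 \<xi> * (v - u)" if "0 \<le> u" "u < v" "v \<le> x + t" for u v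
    by (rule mvt_simple[of _ _ h "\<lambda>\<xi> d. h1 \<xi> * d"])
       (use h that in \<open>auto simp: has_field_derivative_def\<close>)
  have hmono: "h u \<le> h v" if uv: "0 \<le> u" "u \<le> v" "v \<le> x + t" for u v
  proof (cases "u = v")
    case False
    then obtain \<xi> where "\<xi> \<in> {u<..<v}" "h v - h u = h1 \<xi> * (v - u)"
      using mvt[of u v] uv by (metis order_le_less)
    moreover from this have "h1 \<xi> * (v - u) \<ge> 0" using pos[of \<xi>] uv by auto
    ultimately show ?thesis by linarith
  qed auto
  have "h (x+t) + h (t-x) - 2 * h x \<ge> 0"
  proof (cases "x \<le> t - x")
    case True
    then show ?thesis using hmono[of x "t-x"] hmono[of x "x+t"] assms(1,2) by auto
  next
    \<comment> \<open>Here \<open>t - x < x\<close>. The interval to the left of \<open>x\<close>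
      has length \<open>2 * x - t\<close>, which is less than \<open>t\<close>; since the slopes are
      nonnegative, the larger slope over the longer interval wins.\<close>
    case False
    obtain \<xi> where \<xi>: "\<xi> \<in> {x<..<x+t}" "h (x+t) - h x = h1 \<xi> * t" using mvt[of x "x+t"] assms by auto
    obtain \<zeta> where \<zeta>: "\<zeta> \<in> {t-x<..<x}" "h x - h (t-x) = h1 \<zeta> * (x - (t - x))"
      using mvt[of "t-x" x] assms False by auto
    have "h1 \<zeta> * (x - (t - x)) \<le> h1 \<xi> * t"
      by (rule mult_mono) (use mono[of \<zeta> \<xi>] pos[of \<xi>] \<xi> \<zeta> assms(1,2) in auto)
    then show ?thesis using \<xi> \<zeta> by linarith
  qed
  \<comment> \<open>The parabola is even, so using \<open>t - x\<close> in place of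
    \<open>x - t\<close> still gives it the second difference \<open>m * t\<^sup>2\<close>.\<close>
  then show ?thesis unfolding h_def by (simp add: power2_eq_square field_simps)
qed

section \<open>Radial averages of almost subharmonic functions\<close>

definition bump :: "'a::euclidean_space \<Rightarrow> real \<Rightarrow> 'a \<Rightarrow> real" where
  "bump z s x = max 0 (s\<^sup>2 - (x - z) \<bullet> (x - z))"

text \<open>The exponent is the scaling one: \<open>bump z s\<close> squared has size
  \<open>s ^ 4\<close> on a ball of volume proportional to \<open>s ^ DIM('a)\<close>, so the total
  mass does not depend on \<open>s\<close>.\<close>

definition bump_kernel :: "'a::euclidean_space \<Rightarrow> real \<Rightarrow> 'a \<Rightarrow> real" where
  "bump_kernel z s x = (bump z s x)\<^sup>2 / s ^ (DIM('a) + 4)"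

text \<open>This is the trace of the Hessian (the opposite sign to \<open>pos_laplacian\<close>) of
  \<open>u\<^sup>3 / 6\<close> for \<open>u = bump z s\<close>, written without \<open>|x - z|\<^sup>2\<close> by
  means of \<open>u (s\<^sup>2 - |x - z|\<^sup>2) = u\<^sup>2\<close>.\<close>

definition bump_laplacian :: "'a::euclidean_space \<Rightarrow> real \<Rightarrow> 'a \<Rightarrow> real" where
  "bump_laplacian z s x = 4 * s\<^sup>2 * bump z s x - (real DIM('a) + 4) * (bump z s x)\<^sup>2"

lemma bump_nonneg [simp]: "0 \<le> bump z s x"
  by (simp add: bump_def)

lemma bump_outside: "0 \<le> s \<Longrightarrow> s \<le> dist z x \<Longrightarrow> bump z s x = 0"
  using power_mono[of s "dist z x" 2]
  by (simp add: bump_def dist_norm norm_minus_commute flip: power2_norm_eq_inner)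

lemma bump_le: "bump z s x \<le> s\<^sup>2"
  by (simp add: bump_def)

lemma continuous_on_bump [continuous_intros]:
  assumes "continuous_on S f" "continuous_on S g"
  shows "continuous_on S (\<lambda>x. bump z (f x) (g x))"
  unfolding bump_def by (intro continuous_intros assms)

text \<open>Along a unit direction \<open>b\<close> the untruncated paraboloid has derivative
  \<open>-2\<close> times \<open>(x + \<tau> *\<^sub>R b - z) \<bullet> b\<close>; the factor
  \<open>1 / 6\<close> normalises the chain rule for the cube.\<close>

lemma bump_line_derivs:
  fixes b :: "'a::euclidean_space"
  assumes "norm b = 1"
  shows "((\<lambda>\<tau>. bump z s (x + \<tau> *\<^sub>R b) ^ 3 / 6) has_real_derivative
            - (bump z s (x + \<tau> *\<^sub>R b))\<^sup>2 * ((x + \<tau> *\<^sub>R b - z) \<bullet> b)) (at \<tau> within T)"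
    and "((\<lambda>\<tau>. - (bump z s (x + \<tau> *\<^sub>R b))\<^sup>2 * ((x + \<tau> *\<^sub>R b - z) \<bullet> b)) has_real_derivative
            4 * bump z s (x + \<tau> *\<^sub>R b) * ((x + \<tau> *\<^sub>R b - z) \<bullet> b)\<^sup>2 - (bump z s (x + \<tau> *\<^sub>R b))\<^sup>2)
          (at \<tau> within T)"
proof -
  have [simp]: "b \<bullet> b = 1" using assms by (simp add: norm_eq_1)
  define u where "u \<tau> = s\<^sup>2 - (x + \<tau> *\<^sub>R b - z) \<bullet> (x + \<tau> *\<^sub>R b - z)" for \<tau>
  define l where "l \<tau> = (x + \<tau> *\<^sub>R b - z) \<bullet> b" for \<tau>
  have l_eq: "l = (\<lambda>\<tau>. (x - z) \<bullet> b + \<tau>)"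
    by (auto simp: l_def algebra_simps)
  have u_eq: "u = (\<lambda>\<tau>. s\<^sup>2 - (x - z) \<bullet> (x - z) - 2 * \<tau> * ((x - z) \<bullet> b) - \<tau>\<^sup>2)"
    by (auto simp: u_def algebra_simps inner_commute power2_eq_square)
  have u: "(u has_real_derivative - 2 * l \<tau>) (at \<tau> within T)" for T
    unfolding u_eq l_eq by (auto intro!: derivative_eq_intros)
  have l: "(l has_real_derivative 1) (at \<tau> within T)" for T
    unfolding l_eq by (auto intro!: derivative_eq_intros)
  have sq: "((\<lambda>\<tau>. (max 0 (u \<tau>))\<^sup>2) has_real_derivative 2 * max 0 (u \<tau>) * (- 2 * l \<tau>)) (at \<tau> within T)"
    using DERIV_chain2[OF max0_square_deriv u] .
  have "((\<lambda>\<tau>. (max 0 (u \<tau>)) ^ 3) has_real_derivative 3 * (max 0 (u \<tau>))\<^sup>2 * (- 2 * l \<tau>)) (at \<tau> within T)"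
    using DERIV_chain2[OF max0_cube_deriv u] .
  from DERIV_cdivide[OF this, of 6]
  show "((\<lambda>\<tau>. bump z s (x + \<tau> *\<^sub>R b) ^ 3 / 6) has_real_derivative
            - (bump z s (x + \<tau> *\<^sub>R b))\<^sup>2 * ((x + \<tau> *\<^sub>R b - z) \<bullet> b)) (at \<tau> within T)"
    by (simp add: bump_def u_def l_def)
  from DERIV_mult'[OF DERIV_minus[OF sq] l]
  show "((\<lambda>\<tau>. - (bump z s (x + \<tau> *\<^sub>R b))\<^sup>2 * ((x + \<tau> *\<^sub>R b - z) \<bullet> b)) has_real_derivative
            4 * bump z s (x + \<tau> *\<^sub>R b) * ((x + \<tau> *\<^sub>R b - z) \<bullet> b)\<^sup>2 - (bump z s (x + \<tau> *\<^sub>R b))\<^sup>2)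
          (at \<tau> within T)"
    unfolding bump_def u_def[symmetric] l_def[symmetric]
    by (rule DERIV_cong) (simp add: power2_eq_square)
qed

lemma sum_bump_second_derivs:
  "(\<Sum>b\<in>Basis. 4 * bump z s x * ((x - z) \<bullet> b)\<^sup>2 - (bump z s x)\<^sup>2) = bump_laplacian z s x"
proof -
  have *: "bump z s x * ((x - z) \<bullet> (x - z)) = s\<^sup>2 * bump z s x - (bump z s x)\<^sup>2"
    by (auto simp: bump_def max_def power2_eq_square algebra_simps)
  have "(\<Sum>b\<in>Basis. 4 * bump z s x * ((x - z) \<bullet> b)\<^sup>2 - (bump z s x)\<^sup>2)
      = 4 * (bump z s x * ((x - z) \<bullet> (x - z))) - real DIM('a) * (bump z s x)\<^sup>2"
    unfolding euclidean_inner[of "x - z" "x - z"]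
    by (simp add: sum_subtractf sum_distrib_left power2_eq_square sum.distrib algebra_simps)
  then show ?thesis unfolding * bump_laplacian_def by (simp add: algebra_simps)
qed

text \<open>The point is that \<open>\<delta>\<close> is uniform in \<open>x\<close>: the second
  derivatives are uniformly continuous on a compact ball, and far from \<open>z\<close> everything
  vanishes. The limit later has to be taken under an integral over \<open>x\<close>.\<close>

lemma bump_second_difference:
  fixes z :: "'a::euclidean_space"
  assumes "0 < s" "0 < \<epsilon>"
  obtains \<delta> where "0 < \<delta>" "\<delta> \<le> 1"
    "\<And>t x b. 0 < t \<Longrightarrow> t < \<delta> \<Longrightarrow> b \<in> Basis \<Longrightarrow>
      \<bar>bump z s (x + t *\<^sub>R b) ^ 3 / 6 + bump z s (x - t *\<^sub>R b) ^ 3 / 6 - 2 * (bump z s x ^ 3 / 6)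
         - t\<^sup>2 * (4 * bump z s x * ((x - z) \<bullet> b)\<^sup>2 - (bump z s x)\<^sup>2)\<bar> \<le> \<epsilon> * t\<^sup>2"
proof -
  define \<eta> where "\<eta> x = bump z s x ^ 3 / 6" for x
  define \<eta>2 where "\<eta>2 b x = 4 * bump z s x * ((x - z) \<bullet> b)\<^sup>2 - (bump z s x)\<^sup>2" for b x
  \<comment> \<open>The radius \<open>s + 2\<close> leaves room: points within \<open>s + 1\<close>
    of \<open>z\<close> are shifted by less than 1, and points beyond \<open>s + 1\<close> cannot be
    shifted into the support.\<close>
  have "\<forall>b\<in>Basis. \<exists>d>0. \<forall>x\<in>cball z (s+2). \<forall>x'\<in>cball z (s+2). dist x' x < d \<longrightarrow> \<bar>\<eta>2 b x' - \<eta>2 b x\<bar> < \<epsilon>"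
  proof
    fix b :: 'a assume "b \<in> Basis"
    have "uniformly_continuous_on (cball z (s+2)) (\<eta>2 b)"
      by (rule compact_uniformly_continuous) (auto simp: \<eta>2_def intro!: continuous_intros)
    then show "\<exists>d>0. \<forall>x\<in>cball z (s+2). \<forall>x'\<in>cball z (s+2). dist x' x < d \<longrightarrow> \<bar>\<eta>2 b x' - \<eta>2 b x\<bar> < \<epsilon>"
      using assms(2) unfolding uniformly_continuous_on_def dist_real_def by blast
  qed
  then obtain d where d: "\<And>b. b \<in> Basis \<Longrightarrow> d b > 0"
    "\<And>b x x'. b \<in> Basis \<Longrightarrow> x \<in> cball z (s+2) \<Longrightarrow> x' \<in> cball z (s+2) \<Longrightarrow> dist x' x < d b
       \<Longrightarrow> \<bar>\<eta>2 b x' - \<eta>2 b x\<bar> < \<epsilon>"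
    by metis
  define \<delta> where "\<delta> = min 1 (Min (d ` Basis))"
  have \<delta>: "0 < \<delta>" "\<delta> \<le> 1" "\<And>b. b \<in> Basis \<Longrightarrow> \<delta> \<le> d b"
    using d(1) by (auto simp: \<delta>_def Min_gr_iff intro: min.coboundedI2)
  have "\<bar>\<eta> (x + t *\<^sub>R b) + \<eta> (x - t *\<^sub>R b) - 2 * \<eta> x - t\<^sup>2 * \<eta>2 b x\<bar> \<le> \<epsilon> * t\<^sup>2"
    if t: "0 < t" "t < \<delta>" and b: "b \<in> Basis" for t x b
  proof (cases "dist z x \<le> s + 1")
    case False
    have "dist z x \<le> dist z (x + c *\<^sub>R b) + \<bar>c\<bar>" for c
      using dist_triangle[of z x "x + c *\<^sub>R b"] b by (simp add: dist_norm)
    from this[of t] this[of "-t"] have "s \<le> dist z (x + t *\<^sub>R b)" "s \<le> dist z (x - t *\<^sub>R b)" "s \<le> dist z x"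
      using False t \<delta> by auto
    then show ?thesis using assms by (simp add: \<eta>_def \<eta>2_def bump_outside)
  next
    case True
    have near: "\<bar>\<eta>2 b (x + \<tau> *\<^sub>R b) - \<eta>2 b x\<bar> \<le> \<epsilon>" if "\<tau> \<in> {-t..t}" for \<tau>
    proof -
      have "dist z (x + \<tau> *\<^sub>R b) \<le> dist z x + \<bar>\<tau>\<bar>"
        using dist_triangle[of z "x + \<tau> *\<^sub>R b" x] b by (simp add: dist_norm)
      then have "\<bar>\<eta>2 b (x + \<tau> *\<^sub>R b) - \<eta>2 b x\<bar> < \<epsilon>"
        using that t b True \<delta>(2) \<delta>(3)[OF b] by (intro d(2)) (auto simp: dist_norm abs_le_iff)
      then show ?thesis by simp
    qed
    have lower: "\<eta>2 b x - \<epsilon> \<le> \<eta>2 b (x + \<tau> *\<^sub>R b)" and upper: "- \<eta>2 b x - \<epsilon> \<le> - \<eta>2 b (x + \<tau> *\<^sub>R b)"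
      if "\<tau> \<in> {-t..t}" for \<tau>
      using near[OF that] by (auto simp: abs_le_iff)
    have nb: "norm b = 1" using b by simp
    define g where "g \<tau> = \<eta> (x + \<tau> *\<^sub>R b)" for \<tau>
    define g1 where "g1 \<tau> = - (bump z s (x + \<tau> *\<^sub>R b))\<^sup>2 * ((x + \<tau> *\<^sub>R b - z) \<bullet> b)" for \<tau>
    define g2 where "g2 \<tau> = \<eta>2 b (x + \<tau> *\<^sub>R b)" for \<tau>
    have g: "(g has_real_derivative g1 \<tau>) (at \<tau> within T)" "(g1 has_real_derivative g2 \<tau>) (at \<tau> within T)" for \<tau> T
      unfolding g_def g1_def g2_def \<eta>_def \<eta>2_def by (rule bump_line_derivs[OF nb])+
    \<comment> \<open>The lower bound applied to \<open>g\<close> and to \<open>- g\<close> gives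
      the two-sided estimate.\<close>
    have "g (0+t) + g (0-t) - 2 * g 0 \<ge> (\<eta>2 b x - \<epsilon>) * t\<^sup>2"
      by (rule second_difference_ge[where ?g1.0 = g1 and ?g2.0 = g2])
         (use t g lower in \<open>auto simp: g2_def\<close>)
    moreover have "(- g (0+t)) + (- g (0-t)) - 2 * (- g 0) \<ge> (- \<eta>2 b x - \<epsilon>) * t\<^sup>2"
      by (rule second_difference_ge[where ?g1.0 = "\<lambda>\<tau>. - g1 \<tau>" and ?g2.0 = "\<lambda>\<tau>. - g2 \<tau>"])
         (use t g upper in \<open>auto simp: g2_def intro!: DERIV_minus\<close>)
    ultimately show ?thesis by (simp add: g_def abs_le_iff algebra_simps)
  qed
  then show thesis using \<delta>(1,2) by (intro that) (auto simp: \<eta>_def \<eta>2_def)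
qed

text \<open>Replaces a nonnegative Hessian trace for functions with a convex kink.\<close>

definition almost_subharmonic_on :: "'a::euclidean_space set \<Rightarrow> ('a \<Rightarrow> real) \<Rightarrow> bool" where
  "almost_subharmonic_on S V \<longleftrightarrow>
     (\<forall>\<epsilon>>0. \<exists>\<delta>>0. \<forall>t. 0 < t \<longrightarrow> t < \<delta> \<longrightarrow>
        (\<forall>x\<in>S. (\<Sum>b\<in>Basis. V (x + t *\<^sub>R b) + V (x - t *\<^sub>R b) - 2 * V x) \<ge> - \<epsilon> * t\<^sup>2))"

lemma integrable_bump_product:
  fixes f :: "'a::euclidean_space \<Rightarrow> real"
  assumes "continuous_on UNIV f" "\<And>x. s \<le> dist z x \<Longrightarrow> f x = 0"
  shows "integrable lborel f"
  by (rule integrable_continuous_compact_support[OF assms(1) compact_cball[of z s]]) (use assms(2) in auto)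

text \<open>This is a discrete integration by parts. The second differences of \<open>V\<close>,
  tested against \<open>bump z s x ^ 3 / 6\<close>, are at least of order
  \<open>- \<epsilon> * t\<^sup>2\<close>; translation moves them onto the test function, where they
  equal \<open>t\<^sup>2\<close> times \<open>bump_laplacian\<close> up to a uniform error. Dividing
  by \<open>t\<^sup>2\<close> and letting \<open>\<epsilon>\<close> tend to 0 gives the
  sign.\<close>

lemma integral_bump_laplacian_nonneg:
  fixes V :: "'a::euclidean_space \<Rightarrow> real"
  assumes V: "continuous_on UNIV V" and "0 < s" and sub: "almost_subharmonic_on (cball z s) V"
  shows "0 \<le> (\<integral>x. V x * bump_laplacian z s x \<partial>lborel)"
proof -
  define \<eta> where "\<eta> x = bump z s x ^ 3 / 6" for x
  define \<eta>2 where "\<eta>2 b x = 4 * bump z s x * ((x - z) \<bullet> b)\<^sup>2 - (bump z s x)\<^sup>2" for b x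
  define L where "L = (\<integral>x. V x * bump_laplacian z s x \<partial>lborel)"
  define C1 where "C1 = (\<integral>x. \<eta> x \<partial>lborel)"
  \<comment> \<open>An integrable majorant of \<open>|V|\<close> on the ball of radius
    \<open>s + 1\<close>, which contains the supports of the shifted test functions: there
    \<open>bump z (s+2)\<close> is at least \<open>(s+2)^2 - (s+1)^2\<close>, hence at least
    1.\<close>
  define W where "W = (\<lambda>x. \<bar>V x\<bar> * bump z (s+2) x)"
  define C2 where "C2 = (\<integral>x. W x \<partial>lborel)"
  have Vc: "continuous_on S (\<lambda>x. V (h x))" if "continuous_on S h" for S h
    using continuous_on_compose2[OF V that] by auto
  have eta_cont: "continuous_on S (\<lambda>x. \<eta> (h x))" if "continuous_on S h" for S h
    unfolding \<eta>_def by (auto intro!: continuous_intros that)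
  have eta_nonneg: "0 \<le> \<eta> x" for x by (simp add: \<eta>_def)
  have eta_outside: "\<eta> x = 0" if "s \<le> dist z x" for x
    using that assms by (simp add: \<eta>_def bump_outside)
  have Wint: "integrable lborel W"
    by (rule integrable_bump_product[of _ "s+2" z])
       (use assms in \<open>auto simp: W_def bump_outside intro!: continuous_intros Vc\<close>)
  have Wnn: "W x \<ge> 0" for x by (simp add: W_def)
  have Lint: "integrable lborel (\<lambda>x. V x * bump_laplacian z s x)"
    by (rule integrable_bump_product[of _ s z])
       (use assms in \<open>auto simp: bump_outside bump_laplacian_def intro!: continuous_intros Vc\<close>)
  have eint: "integrable lborel \<eta>"
    by (rule integrable_bump_product[of _ s z])
       (use eta_outside in \<open>auto intro!: continuous_intros eta_cont\<close>)
  have C: "C1 \<ge> 0" "C2 \<ge> 0"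
    unfolding C1_def C2_def by (auto intro!: integral_nonneg_AE simp: eta_nonneg Wnn)
  have key: "- \<epsilon> * (C1 + real DIM('a) * C2) \<le> L" if "0 < \<epsilon>" for \<epsilon>
  proof -
    obtain \<delta>1 where \<delta>1: "0 < \<delta>1" "\<And>t x. 0 < t \<Longrightarrow> t < \<delta>1 \<Longrightarrow> x \<in> cball z s \<Longrightarrow>
        (\<Sum>b\<in>Basis. V (x + t *\<^sub>R b) + V (x - t *\<^sub>R b) - 2 * V x) \<ge> - \<epsilon> * t\<^sup>2"
      using sub \<open>0 < \<epsilon>\<close> unfolding almost_subharmonic_on_def by meson
    obtain \<delta>2 where \<delta>2: "0 < \<delta>2" "\<delta>2 \<le> 1" "\<And>t x b. 0 < t \<Longrightarrow> t < \<delta>2 \<Longrightarrow> b \<in> Basis \<Longrightarrow>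
        \<bar>\<eta> (x + t *\<^sub>R b) + \<eta> (x - t *\<^sub>R b) - 2 * \<eta> x - t\<^sup>2 * \<eta>2 b x\<bar> \<le> \<epsilon> * t\<^sup>2"
      using bump_second_difference[OF \<open>0 < s\<close> \<open>0 < \<epsilon>\<close>, of z] unfolding \<eta>_def \<eta>2_def by metis
    define t where "t = min \<delta>1 \<delta>2 / 2"
    have t: "0 < t" "t < \<delta>1" "t < \<delta>2" "t \<le> 1" using \<delta>1(1) \<delta>2(1,2) by (auto simp: t_def)
    define D where "D b x = \<eta> (x + t *\<^sub>R b) + \<eta> (x - t *\<^sub>R b) - 2 * \<eta> x" for b x
    define E where "E b x = V (x + t *\<^sub>R b) + V (x - t *\<^sub>R b) - 2 * V x" for b x
    have D_outside: "D b x = 0" if "s + 1 \<le> dist z x" "b \<in> Basis" for b x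
    proof -
      have "dist z x \<le> dist z (x + c *\<^sub>R b) + \<bar>c\<bar>" for c
        using dist_triangle[of z x "x + c *\<^sub>R b"] that by (simp add: dist_norm)
      from this[of t] this[of "-t"] show ?thesis using that t by (simp add: D_def eta_outside)
    qed
    have Dint: "integrable lborel (\<lambda>x. V x * D b x)" if "b \<in> Basis" for b
      by (rule integrable_bump_product[of _ "s+1" z])
         (use that D_outside in \<open>auto simp: D_def[abs_def] intro!: continuous_intros Vc eta_cont\<close>)
    have Eint: "integrable lborel (\<lambda>x. \<eta> x * E b x)" for b
      by (rule integrable_bump_product[of _ s z])
         (auto simp: E_def eta_outside intro!: continuous_intros Vc eta_cont)
    have shift: "integrable lborel (\<lambda>x. \<eta> x * V (x + c *\<^sub>R b))" "integrable lborel (\<lambda>x. V x * \<eta> (x - c *\<^sub>R b))"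
      "(\<integral>x. \<eta> x * V (x + c *\<^sub>R b) \<partial>lborel) = (\<integral>x. V x * \<eta> (x - c *\<^sub>R b) \<partial>lborel)"
      if "b \<in> Basis" for b c
    proof -
      show "integrable lborel (\<lambda>x. \<eta> x * V (x + c *\<^sub>R b))"
        by (rule integrable_bump_product[of _ s z])
           (auto simp: eta_outside intro!: continuous_intros Vc eta_cont)
      have "\<eta> (x - c *\<^sub>R b) = 0" if "s + \<bar>c\<bar> \<le> dist z x" for x
        using dist_triangle[of z x "x - c *\<^sub>R b"] \<open>b \<in> Basis\<close> that by (intro eta_outside) (simp add: dist_norm)
      then show "integrable lborel (\<lambda>x. V x * \<eta> (x - c *\<^sub>R b))"
        by (intro integrable_bump_product[of _ "s + \<bar>c\<bar>" z])
           (auto intro!: continuous_intros Vc eta_cont)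
      have "(\<integral>x. V (c *\<^sub>R b + x) * \<eta> (c *\<^sub>R b + x - c *\<^sub>R b) \<partial>lborel) = (\<integral>x. V x * \<eta> (x - c *\<^sub>R b) \<partial>lborel)"
        by (rule lborel_integral_translate)
           (auto intro!: borel_measurable_continuous_onI continuous_intros Vc eta_cont)
      then show "(\<integral>x. \<eta> x * V (x + c *\<^sub>R b) \<partial>lborel) = (\<integral>x. V x * \<eta> (x - c *\<^sub>R b) \<partial>lborel)"
        by (simp add: algebra_simps)
    qed
    have swap: "(\<integral>x. \<eta> x * E b x \<partial>lborel) = (\<integral>x. V x * D b x \<partial>lborel)" if b: "b \<in> Basis" for b
    proof -
      \<comment> \<open>All three terms are written as shifts, by \<open>t\<close>,
        \<open>-t\<close> and \<open>0\<close>, so that \<open>shift\<close> applies to each of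
        them.\<close>
      have "(\<integral>x. \<eta> x * E b x \<partial>lborel)
          = (\<integral>x. \<eta> x * V (x + t *\<^sub>R b) + \<eta> x * V (x + (-t) *\<^sub>R b) - 2 * (\<eta> x * V (x + 0 *\<^sub>R b)) \<partial>lborel)"
        by (rule Bochner_Integration.integral_cong) (auto simp: E_def algebra_simps)
      also have "\<dots> = (\<integral>x. \<eta> x * V (x + t *\<^sub>R b) \<partial>lborel) + (\<integral>x. \<eta> x * V (x + (-t) *\<^sub>R b) \<partial>lborel)
          - 2 * (\<integral>x. \<eta> x * V (x + 0 *\<^sub>R b) \<partial>lborel)"
        by (subst Bochner_Integration.integral_diff Bochner_Integration.integral_add
            Bochner_Integration.integral_mult_right |
            intro Bochner_Integration.integrable_add Bochner_Integration.integrable_mult_right shift(1) b)+ simp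
      also have "\<dots> = (\<integral>x. V x * \<eta> (x - t *\<^sub>R b) \<partial>lborel) + (\<integral>x. V x * \<eta> (x - (-t) *\<^sub>R b) \<partial>lborel)
          - 2 * (\<integral>x. V x * \<eta> (x - 0 *\<^sub>R b) \<partial>lborel)"
        by (simp only: shift(3)[OF b])
      also have "\<dots> = (\<integral>x. V x * \<eta> (x - t *\<^sub>R b) + V x * \<eta> (x - (-t) *\<^sub>R b) - 2 * (V x * \<eta> (x - 0 *\<^sub>R b)) \<partial>lborel)"
        by (subst Bochner_Integration.integral_diff Bochner_Integration.integral_add
            Bochner_Integration.integral_mult_right |
            intro Bochner_Integration.integrable_add Bochner_Integration.integrable_mult_right shift(2) b)+ simp
      also have "\<dots> = (\<integral>x. V x * D b x \<partial>lborel)"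
        by (rule Bochner_Integration.integral_cong) (auto simp: D_def algebra_simps)
      finally show ?thesis .
    qed
    have "- \<epsilon> * t\<^sup>2 * C1 = (\<integral>x. - \<epsilon> * t\<^sup>2 * \<eta> x \<partial>lborel)"
      unfolding C1_def by simp
    also have "\<dots> \<le> (\<integral>x. (\<Sum>b\<in>Basis. \<eta> x * E b x) \<partial>lborel)"
    proof (rule integral_mono)
      fix x :: 'a
      show "- \<epsilon> * t\<^sup>2 * \<eta> x \<le> (\<Sum>b\<in>Basis. \<eta> x * E b x)"
      proof (cases "x \<in> cball z s")
        case True
        from mult_left_mono[OF \<delta>1(2)[OF t(1,2) this] eta_nonneg[of x]] show ?thesis
          by (simp add: E_def sum_distrib_left mult_ac)
      qed (simp add: eta_outside)
    qed (use eint Eint in auto)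
    also have "\<dots> = (\<Sum>b\<in>Basis. \<integral>x. \<eta> x * E b x \<partial>lborel)"
      by (rule Bochner_Integration.integral_sum) (rule Eint)
    also have "\<dots> = (\<Sum>b\<in>Basis. \<integral>x. V x * D b x \<partial>lborel)"
      by (simp add: swap)
    also have "\<dots> = (\<integral>x. (\<Sum>b\<in>Basis. V x * D b x) \<partial>lborel)"
      by (rule Bochner_Integration.integral_sum[symmetric]) (rule Dint)
    also have "\<dots> \<le> (\<integral>x. t\<^sup>2 * (V x * bump_laplacian z s x) + \<epsilon> * t\<^sup>2 * real DIM('a) * W x \<partial>lborel)"
    proof (rule integral_mono)
      fix x :: 'a
      show "(\<Sum>b\<in>Basis. V x * D b x) \<le> t\<^sup>2 * (V x * bump_laplacian z s x) + \<epsilon> * t\<^sup>2 * real DIM('a) * W x"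
      proof (cases "dist z x \<le> s + 1")
        case True
        have "dist z x * dist z x \<le> (s+1) * (s+1)" using True assms by (intro mult_mono) auto
        then have "1 \<le> bump z (s+2) x"
          using assms by (simp add: bump_def dist_norm norm_minus_commute power2_eq_square algebra_simps
            flip: power2_norm_eq_inner)
        then have W: "\<bar>V x\<bar> \<le> W x" unfolding W_def using mult_left_mono[of 1 _ "\<bar>V x\<bar>"] by auto
        have "V x * D b x \<le> t\<^sup>2 * (V x * \<eta>2 b x) + \<epsilon> * t\<^sup>2 * W x" if b: "b \<in> Basis" for b
        proof -
          have "V x * (D b x - t\<^sup>2 * \<eta>2 b x) \<le> \<bar>V x\<bar> * \<bar>D b x - t\<^sup>2 * \<eta>2 b x\<bar>"
            by (simp flip: abs_mult)
          also have "\<dots> \<le> W x * (\<epsilon> * t\<^sup>2)"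
            using \<delta>2(3)[OF t(1,3) b, of x] W Wnn by (intro mult_mono) (auto simp: D_def)
          finally show ?thesis by (simp add: algebra_simps)
        qed
        then have "(\<Sum>b\<in>Basis. V x * D b x) \<le> (\<Sum>b\<in>Basis. t\<^sup>2 * (V x * \<eta>2 b x) + \<epsilon> * t\<^sup>2 * W x)"
          by (intro sum_mono)
        also have "\<dots> = t\<^sup>2 * (V x * (\<Sum>b\<in>Basis. \<eta>2 b x)) + \<epsilon> * t\<^sup>2 * real DIM('a) * W x"
          by (simp add: sum.distrib sum_distrib_left mult_ac)
        finally show ?thesis by (simp add: \<eta>2_def sum_bump_second_derivs)
      next
        case False
        then show ?thesis using D_outside[of x] Wnn \<open>0 < \<epsilon>\<close> assms by (simp add: bump_laplacian_def bump_outside)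
      qed
    qed (use Dint Lint Wint in auto)
    also have "\<dots> = t\<^sup>2 * L + \<epsilon> * t\<^sup>2 * real DIM('a) * C2"
      unfolding L_def C2_def using Lint Wint by simp
    finally have "t\<^sup>2 * (- \<epsilon> * (C1 + real DIM('a) * C2)) \<le> t\<^sup>2 * L" by (simp add: algebra_simps)
    then show ?thesis by (rule mult_left_le_imp_le) (use t(1) in simp)
  qed
  have "0 \<le> L"
  proof (rule ccontr)
    assume L: "\<not> 0 \<le> L"
    define M where "M = C1 + real DIM('a) * C2"
    have M: "M \<ge> 0" using C by (simp add: M_def)
    \<comment> \<open>The choice \<open>\<epsilon> = - L / (M + 1)\<close> makes the error strictly
      smaller than \<open>|L|\<close>; the \<open>+ 1\<close> covers \<open>M = 0\<close>.\<close>
    have "- (- L / (M + 1)) * M \<le> L" unfolding M_def by (rule key) (use L M in \<open>auto simp: M_def intro!: divide_neg_pos\<close>)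
    then have "L * M / (M + 1) \<le> L" by simp
    then have "L * M \<le> L * (M + 1)" using M by (simp add: pos_divide_le_eq)
    then show False using L by (simp add: algebra_simps)
  qed
  then show ?thesis by (simp add: L_def)
qed

lemma almost_subharmonic_on_subset:
  "almost_subharmonic_on S V \<Longrightarrow> T \<subseteq> S \<Longrightarrow> almost_subharmonic_on T V"
  unfolding almost_subharmonic_on_def by (meson subsetD)

lemma almost_subharmonic_on_const: "almost_subharmonic_on S (\<lambda>_. c)"
  unfolding almost_subharmonic_on_def by (auto intro!: exI[of _ 1])

section \<open>Monotonicity of kernel averages in the radius\<close>

text \<open>The exponent \<open>DIM('a) + 4\<close> is exactly the one for which the quotient rule
  produces \<open>bump_laplacian\<close>. This ties the growth of averages in \<open>s\<close> to
  the sign of the tested second derivative.\<close>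

lemma bump_kernel_has_derivative:
  fixes z :: "'a::euclidean_space"
  assumes "0 < s"
  shows "((\<lambda>s. bump_kernel z s x) has_real_derivative bump_laplacian z s x / s ^ (DIM('a) + 5)) (at s within T)"
proof -
  define u where "u s = s\<^sup>2 - (x - z) \<bullet> (x - z)" for s
  have u: "(u has_real_derivative 2 * s) (at s within T)"
    unfolding u_def by (auto intro!: derivative_eq_intros)
  have "((\<lambda>s. (max 0 (u s))\<^sup>2) has_real_derivative 2 * max 0 (u s) * (2 * s)) (at s within T)"
    using DERIV_chain2[OF max0_square_deriv u] .
  then have b: "((\<lambda>s. (bump z s x)\<^sup>2) has_real_derivative 4 * s * bump z s x) (at s within T)"
    by (simp add: bump_def u_def mult_ac)
  have p: "((\<lambda>s. s ^ (DIM('a) + 4)) has_real_derivative (real DIM('a) + 4) * s ^ (DIM('a) + 3)) (at s within T)"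
    by (auto intro!: derivative_eq_intros simp: add.commute)
  have "(4 * s * bump z s x * s ^ (DIM('a) + 4) - (bump z s x)\<^sup>2 * ((real DIM('a) + 4) * s ^ (DIM('a) + 3)))
          / (s ^ (DIM('a) + 4) * s ^ (DIM('a) + 4)) = bump_laplacian z s x / s ^ (DIM('a) + 5)"
    using assms by (simp add: bump_laplacian_def power_add field_simps eval_nat_numeral)
  then show ?thesis
    unfolding bump_kernel_def using DERIV_divide[OF b p] assms by simp
qed

lemma continuous_on_bump_kernel:
  fixes z :: "'a::euclidean_space"
  shows "continuous_on S (bump_kernel z s)"
proof (cases "s = 0")
  case False
  then show ?thesis unfolding bump_kernel_def by (auto intro!: continuous_intros)
\<comment> \<open>For \<open>s = 0\<close> the denominator is zero, and division by zero makes the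
  kernel constantly 0.\<close>
qed (simp add: bump_kernel_def[abs_def] power_0_left)

lemma bump_kernel_outside: "0 \<le> s \<Longrightarrow> s \<le> dist z x \<Longrightarrow> bump_kernel z s x = 0"
  by (simp add: bump_kernel_def bump_outside)

lemma bump_kernel_nonneg: "0 \<le> s \<Longrightarrow> 0 \<le> bump_kernel z s x"
  by (simp add: bump_kernel_def)

lemma bump_kernel_le:
  fixes z :: "'a::euclidean_space"
  assumes "0 < s"
  shows "bump_kernel z s x \<le> 1 / s ^ DIM('a)"
proof -
  have "(bump z s x)\<^sup>2 \<le> (s\<^sup>2)\<^sup>2" by (intro power_mono bump_le bump_nonneg)
  then have "(bump z s x)\<^sup>2 / s ^ (DIM('a) + 4) \<le> (s\<^sup>2)\<^sup>2 / s ^ (DIM('a) + 4)"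
    using assms by (intro divide_right_mono) auto
  also have "\<dots> = 1 / s ^ DIM('a)" using assms by (simp add: power_add field_simps flip: power_mult)
  finally show ?thesis by (simp add: bump_kernel_def)
qed

lemma integrable_bump_kernel:
  fixes V :: "'a::euclidean_space \<Rightarrow> real"
  assumes "continuous_on UNIV V" "0 \<le> s"
  shows "integrable lborel (\<lambda>x. V x * bump_kernel z s x)"
  by (rule integrable_bump_product[of _ s z])
     (use assms in \<open>auto simp: bump_kernel_outside intro!: continuous_intros continuous_on_bump_kernel\<close>)

text \<open>Differentiation under the integral is done with the gauge integral over a box, while
  translation and monotonicity use the Lebesgue integral; this is the bridge.\<close>

lemma lborel_integral_eq_integral_cbox:
  fixes f :: "'a::euclidean_space \<Rightarrow> real"
  assumes "integrable lborel f" "\<And>x. x \<notin> cbox a b \<Longrightarrow> f x = 0"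
  shows "integral (cbox a b) f = (\<integral>x. f x \<partial>lborel)"
proof -
  have "(f has_integral (\<integral>x. f x \<partial>lborel)) UNIV" by (rule has_integral_integral_lborel[OF assms(1)])
  then have "((\<lambda>x. if x \<in> cbox a b then f x else 0) has_integral (\<integral>x. f x \<partial>lborel)) UNIV"
    by (rule has_integral_eq[rotated]) (use assms(2) in auto)
  then show ?thesis by (simp add: has_integral_restrict_UNIV integral_unique)
qed

text \<open>Differentiating under the integral gives a positive multiple of the integral of
  \<open>V x * bump_laplacian z s x\<close>, which is nonnegative; the mean value theorem then
  compares the two radii.\<close>

lemma bump_average_mono:
  fixes V :: "'a::euclidean_space \<Rightarrow> real"
  assumes V: "continuous_on UNIV V" and s: "0 < s1" "s1 < s2"
    and sub: "almost_subharmonic_on (cball z s2) V"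
  shows "(\<integral>x. V x * bump_kernel z s1 x \<partial>lborel) \<le> (\<integral>x. V x * bump_kernel z s2 x \<partial>lborel)"
proof -
  \<comment> \<open>One box contains the supports for all radii up to \<open>s2\<close>, so the
    domain of integration is independent of \<open>s\<close>.\<close>
  obtain a b where ab: "cball z s2 \<subseteq> cbox a b"
    using bounded_subset_cbox_symmetric[OF bounded_cball] by metis
  define F where "F s = integral (cbox a b) (\<lambda>x. V x * bump_kernel z s x)" for s
  define F' where "F' s = integral (cbox a b) (\<lambda>x. V x * (bump_laplacian z s x / s ^ (DIM('a) + 5)))" for s
  have outside: "s \<le> dist z x" if "x \<notin> cbox a b" "s \<le> s2" for x s
    using that ab by (meson linorder_le_cases mem_cball order_trans subsetD)
  have F: "F s = (\<integral>x. V x * bump_kernel z s x \<partial>lborel)" if "s \<in> {s1..s2}" for s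
    unfolding F_def using that s outside
    by (intro lborel_integral_eq_integral_cbox integrable_bump_kernel V) (auto simp: bump_kernel_outside)
  have "(F has_real_derivative F' s) (at s within {s1..s2})" if "s \<in> {s1..s2}" for s
    unfolding F_def F'_def
  proof (rule leibniz_rule_field_derivative)
    show "((\<lambda>s. V x * bump_kernel z s x) has_real_derivative V x * (bump_laplacian z s x / s ^ (DIM('a) + 5)))
        (at s within {s1..s2})" if "s \<in> {s1..s2}" for s x
      using that s by (intro DERIV_cmult bump_kernel_has_derivative) auto
    show "(\<lambda>x. V x * bump_kernel z s x) integrable_on cbox a b" if "s \<in> {s1..s2}" for s
      by (intro integrable_continuous continuous_intros continuous_on_bump_kernel continuous_on_subset[OF V]) auto
    have "continuous_on ({s1..s2} \<times> cbox a b) (\<lambda>x. V (snd x))"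
      by (rule continuous_on_compose2[OF V]) (auto intro!: continuous_intros)
    then show "continuous_on ({s1..s2} \<times> cbox a b) (\<lambda>(s, x). V x * (bump_laplacian z s x / s ^ (DIM('a) + 5)))"
      unfolding split_beta bump_laplacian_def using s by (auto intro!: continuous_intros)
  qed (use that in auto)
  then have "\<exists>\<xi>\<in>{s1<..<s2}. F s2 - F s1 = F' \<xi> * (s2 - s1)"
    by (intro mvt_simple[of _ _ F "\<lambda>\<xi> d. F' \<xi> * d"]) (use s in \<open>auto simp: has_field_derivative_def\<close>)
  then obtain \<xi> where \<xi>: "s1 < \<xi>" "\<xi> < s2" "F s2 - F s1 = F' \<xi> * (s2 - s1)" by auto
  have "F' \<xi> = integral (cbox a b) (\<lambda>x. (V x * bump_laplacian z \<xi> x) / \<xi> ^ (DIM('a) + 5))"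
    by (simp add: F'_def)
  also have "\<dots> = integral (cbox a b) (\<lambda>x. V x * bump_laplacian z \<xi> x) / \<xi> ^ (DIM('a) + 5)"
    by (rule integral_divide)
  also have "integral (cbox a b) (\<lambda>x. V x * bump_laplacian z \<xi> x) = (\<integral>x. V x * bump_laplacian z \<xi> x \<partial>lborel)"
  proof (rule lborel_integral_eq_integral_cbox)
    show "integrable lborel (\<lambda>x. V x * bump_laplacian z \<xi> x)"
      by (rule integrable_bump_product[of _ \<xi> z])
         (use \<xi> s in \<open>auto simp: bump_outside bump_laplacian_def intro!: continuous_intros V\<close>)
    show "V x * bump_laplacian z \<xi> x = 0" if "x \<notin> cbox a b" for x
      using outside[OF that, of \<xi>] \<xi> s by (simp add: bump_laplacian_def bump_outside)
  qed
  finally have "F' \<xi> = (\<integral>x. V x * bump_laplacian z \<xi> x \<partial>lborel) / \<xi> ^ (DIM('a) + 5)" .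
  moreover have "0 \<le> (\<integral>x. V x * bump_laplacian z \<xi> x \<partial>lborel)"
    using \<xi> s by (intro integral_bump_laplacian_nonneg V almost_subharmonic_on_subset[OF sub]) auto
  ultimately have "F' \<xi> \<ge> 0" using \<xi> s by simp
  then have "F s1 \<le> F s2" using \<xi>(3) s by (smt (verit) mult_nonneg_nonneg)
  then show ?thesis using F s by simp
qed

definition bump_mass :: "'a::euclidean_space itself \<Rightarrow> real" where
  "bump_mass _ = (\<integral>x. bump_kernel (0::'a) 1 x \<partial>lborel)"

text \<open>The constant functions \<open>1\<close> and \<open>-1\<close> are both almost subharmonic, which makes the mass of
  the kernel independent of \<open>s\<close> without a change of variables.\<close>

lemma integral_bump_kernel:
  fixes z :: "'a::euclidean_space"
  assumes "0 < s"
  shows "(\<integral>x. bump_kernel z s x \<partial>lborel) = bump_mass TYPE('a)"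
proof -
  have const: "(\<integral>x. bump_kernel z s1 x \<partial>lborel) = (\<integral>x. bump_kernel z s2 x \<partial>lborel)" if "0 < s1" "s1 < s2" for s1 s2
    using bump_average_mono[of "\<lambda>_. 1", OF _ that almost_subharmonic_on_const, of z]
      bump_average_mono[of "\<lambda>_. -1", OF _ that almost_subharmonic_on_const, of z]
    by simp
  have "(\<integral>x. bump_kernel z s x \<partial>lborel) = (\<integral>x. bump_kernel z 1 x \<partial>lborel)"
  proof (cases s "1::real" rule: linorder_cases)
    case less
    then show ?thesis using assms by (intro const)
  next
    case greater
    then show ?thesis by (intro const[symmetric]) auto
  qed auto
  also have "\<dots> = (\<integral>x. bump_kernel z 1 (z + x) \<partial>lborel)"
    by (rule lborel_integral_translate[symmetric])
       (intro borel_measurable_continuous_onI continuous_on_bump_kernel)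
  also have "\<dots> = bump_mass TYPE('a)"
    by (simp add: bump_mass_def bump_kernel_def bump_def)
  finally show ?thesis .
qed

text \<open>If the mass were zero, the nonnegative kernel would vanish almost everywhere, but it is
  positive on the unit ball.\<close>

lemma bump_mass_pos: "0 < bump_mass TYPE('a::euclidean_space)"
proof -
  have nn: "0 \<le> bump_kernel (0::'a) 1 x" for x by (simp add: bump_kernel_nonneg)
  have int: "integrable lborel (bump_kernel (0::'a) 1)"
    using integrable_bump_kernel[of "\<lambda>_. 1" 1 "0::'a"] by simp
  have "bump_mass TYPE('a) \<ge> 0"
    unfolding bump_mass_def by (rule integral_nonneg_AE) (simp add: nn)
  moreover have "bump_mass TYPE('a) \<noteq> 0"
  proof
    assume "bump_mass TYPE('a) = 0"
    then have "AE x in lborel. bump_kernel (0::'a) 1 x = 0"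
      using integral_nonneg_eq_0_iff_AE[OF int] nn by (simp add: bump_mass_def)
    then have "AE x in lborel. x \<notin> ball (0::'a) 1"
    proof eventually_elim
      case (elim x)
      then have "1 \<le> x \<bullet> x" by (simp add: bump_kernel_def bump_def)
      then show ?case by (simp add: norm_eq_sqrt_inner)
    qed
    then have "emeasure lborel (ball (0::'a) 1) = 0"
      using AE_iff_null_sets[of "ball (0::'a) 1" lborel] by (intro null_setsD1) simp
    then have "measure lborel (ball (0::'a) 1) = 0" unfolding measure_def by simp
    then show False using content_ball_pos[of 1 "0::'a"] by simp
  qed
  ultimately show ?thesis by linarith
qed

text \<open>By continuity, averages over small radii come arbitrarily close to \<open>V z\<close>
  times the mass; by \<open>bump_average_mono\<close> they stay below the average at radius
  \<open>s\<close>.\<close>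

lemma almost_subharmonic_mean_value:
  fixes V :: "'a::euclidean_space \<Rightarrow> real"
  assumes V: "continuous_on UNIV V" and s: "0 < s"
    and sub: "almost_subharmonic_on (cball z s) V"
  shows "V z * bump_mass TYPE('a) \<le> (\<integral>x. V x * bump_kernel z s x \<partial>lborel)"
proof (rule field_le_epsilon)
  fix e :: real assume e: "0 < e"
  define K where "K = bump_mass TYPE('a)"
  have K: "K > 0" unfolding K_def by (rule bump_mass_pos)
  have "isCont V z" using V by (simp add: continuous_on_eq_continuous_at)
  then obtain d where d: "0 < d" "\<And>x. dist x z < d \<Longrightarrow> dist (V x) (V z) < e / K"
    using e K unfolding continuous_at_eps_delta by (metis divide_pos_pos)
  define s' where "s' = min d s / 2"
  have s': "0 < s'" "s' < s" "s' < d" using d(1) s by (auto simp: s'_def)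
  have int1: "integrable lborel (bump_kernel z s')"
    using integrable_bump_kernel[of "\<lambda>_. 1" s' z] s' by simp
  have "V z * K - e = (V z - e / K) * (\<integral>x. bump_kernel z s' x \<partial>lborel)"
    using K by (simp add: integral_bump_kernel[OF s'(1)] K_def[symmetric] field_simps)
  also have "\<dots> = (\<integral>x. (V z - e / K) * bump_kernel z s' x \<partial>lborel)"
    by simp
  also have "\<dots> \<le> (\<integral>x. V x * bump_kernel z s' x \<partial>lborel)"
  proof (rule integral_mono)
    show "(V z - e / K) * bump_kernel z s' x \<le> V x * bump_kernel z s' x" for x
    proof (cases "dist z x < s'")
      case True
      then have "dist (V x) (V z) < e / K" using s' by (intro d) (simp add: dist_commute)
      then show ?thesis using s' by (intro mult_right_mono bump_kernel_nonneg) (auto simp: dist_real_def)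
    next
      case False
      then show ?thesis using s' by (simp add: bump_kernel_outside)
    qed
  qed (use int1 s' in \<open>auto intro!: integrable_bump_kernel V\<close>)
  also have "\<dots> \<le> (\<integral>x. V x * bump_kernel z s x \<partial>lborel)"
    by (rule bump_average_mono[OF V s'(1,2) sub])
  finally show "V z * bump_mass TYPE('a) \<le> (\<integral>x. V x * bump_kernel z s x \<partial>lborel) + e"
    by (simp add: K_def)
qed

section \<open>The half-space mean value inequality\<close>

lemma C2_line_derivs:
  assumes C2: "C2_with_derivs S e De D2e"
    and T: "\<And>\<tau>. \<tau> \<in> T \<Longrightarrow> p + \<tau> *\<^sub>R b \<in> S" and \<tau>: "\<tau> \<in> T"
  shows "((\<lambda>\<tau>. e (p + \<tau> *\<^sub>R b)) has_real_derivative De (p + \<tau> *\<^sub>R b) b) (at \<tau> within T)"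
    and "((\<lambda>\<tau>. De (p + \<tau> *\<^sub>R b) b) has_real_derivative D2e (p + \<tau> *\<^sub>R b) b b) (at \<tau> within T)"
proof -
  have line: "((\<lambda>\<tau>. p + \<tau> *\<^sub>R b) has_derivative (\<lambda>h. h *\<^sub>R b)) (at \<tau> within T)"
    by (auto intro!: derivative_eq_intros)
  have sub: "(\<lambda>\<tau>. p + \<tau> *\<^sub>R b) ` T \<subseteq> S" using T by auto
  have e: "(e has_derivative De (p + \<tau> *\<^sub>R b)) (at (p + \<tau> *\<^sub>R b) within (\<lambda>\<tau>. p + \<tau> *\<^sub>R b) ` T)"
    and De: "(De has_derivative D2e (p + \<tau> *\<^sub>R b)) (at (p + \<tau> *\<^sub>R b) within (\<lambda>\<tau>. p + \<tau> *\<^sub>R b) ` T)"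
    using C2 T[OF \<tau>] sub unfolding C2_with_derivs_def by (blast intro: has_derivative_subset)+
  show "((\<lambda>\<tau>. e (p + \<tau> *\<^sub>R b)) has_real_derivative De (p + \<tau> *\<^sub>R b) b) (at \<tau> within T)"
    using has_derivative_in_compose[OF line e]
    unfolding has_field_derivative_def by (simp add: blinfun.scaleR_right mult.commute[of _ "De _ _"])
  show "((\<lambda>\<tau>. De (p + \<tau> *\<^sub>R b) b) has_real_derivative D2e (p + \<tau> *\<^sub>R b) b b) (at \<tau> within T)"
    using bounded_linear.has_derivative[OF blinfun.bounded_linear_left has_derivative_in_compose[OF line De], of b]
    unfolding has_field_derivative_def
    by (simp add: blinfun.scaleR_right blinfun.scaleR_left mult.commute[of _ "D2e _ _ _"])
qed

lemma C2_with_derivs_subset: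
  "C2_with_derivs S e De D2e \<Longrightarrow> T \<subseteq> S \<Longrightarrow> C2_with_derivs T e De D2e"
  unfolding C2_with_derivs_def by (meson continuous_on_subset has_derivative_subset subsetD)

lemma C2_with_derivs_continuous: "C2_with_derivs S e De D2e \<Longrightarrow> continuous_on S e"
  unfolding C2_with_derivs_def by (meson continuous_on_eq_continuous_within has_derivative_continuous)

text \<open>Precomposition with this map is the even reflection of a function across the
  boundary.\<close>

definition halfspace_fold :: "real \<times> (real^'m) \<Rightarrow> real \<times> (real^'m)" where
  "halfspace_fold x = (\<bar>fst x\<bar>, snd x)"

lemma halfspace_fold_in [simp]: "halfspace_fold x \<in> halfspace"
  by (simp add: halfspace_fold_def halfspace_def)

lemma halfspace_fold_id: "x \<in> halfspace \<Longrightarrow> halfspace_fold x = x"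
  by (simp add: halfspace_fold_def halfspace_def prod_eq_iff)

text \<open>Folding brings a point no further from a centre in the half-space, so it maps a ball
  around \<open>z\<close> into the corresponding half-ball.\<close>

lemma dist_halfspace_fold_le:
  assumes "z \<in> halfspace"
  shows "dist z (halfspace_fold x) \<le> dist z x"
proof -
  have "\<bar>fst z - \<bar>fst x\<bar>\<bar> \<le> \<bar>fst z - fst x\<bar>" using assms by (auto simp: halfspace_def)
  then show ?thesis
    unfolding dist_prod_def halfspace_fold_def
    by (intro real_sqrt_le_mono add_mono power_mono) (auto simp: dist_real_def)
qed

lemma continuous_on_halfspace_fold: "continuous_on S halfspace_fold"
  unfolding halfspace_fold_def by (intro continuous_intros)

lemma closed_halfspace: "closed (halfspace :: (real \<times> (real^'m)) set)"
  unfolding halfspace_def by (intro closed_Collect_le continuous_intros)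

text \<open>The offset \<open>c\<close> keeps the correction terms of size \<open>A \<rho>\<^sup>2 + B \<rho>\<close> far from the boundary; it
  vanishes as soon as the ball meets the boundary, so the normal derivative of the quadratic term is zero there.\<close>

lemma folded_almost_subharmonic:
  fixes z :: "real \<times> (real^'m)" and e :: "real \<times> (real^'m) \<Rightarrow> real"
  assumes z: "z \<in> halfspace" and s: "s < s'" "s' < \<rho>" and AB: "0 \<le> A" "0 \<le> B"
    and C2: "C2_with_derivs (halfball z \<rho>) e De D2e"
    and lap: "\<And>x. x \<in> halfball z \<rho> \<Longrightarrow> pos_laplacian D2e x \<le> A"
    and nor: "\<And>x. x \<in> halfball z \<rho> \<Longrightarrow> fst x = 0 \<Longrightarrow> outer_normal_deriv De x \<le> B"
    and c: "c = max 0 (fst z - \<rho>)"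
    and W: "\<And>x. x \<in> cball z s' \<Longrightarrow>
      W x = e (halfspace_fold x) + A / 2 * (fst (halfspace_fold x) - c)\<^sup>2 + B * (fst (halfspace_fold x) - c)"
  shows "almost_subharmonic_on (cball z s) W"
  unfolding almost_subharmonic_on_def
proof (intro allI impI)
  fix \<epsilon> :: real assume \<epsilon>: "0 < \<epsilon>"
  define v where "v x = e x + A / 2 * (fst x - c)\<^sup>2 + B * (fst x - c)" for x
  define N where "N = real DIM(real \<times> (real^'m))"
  have N: "N > 0" unfolding N_def by (simp only: of_nat_0_less_iff DIM_positive)
  have line: "((\<lambda>\<tau>. v (p + \<tau> *\<^sub>R b)) has_real_derivative
        De (p + \<tau> *\<^sub>R b) b + A * (fst p + \<tau> * fst b - c) * fst b + B * fst b) (at \<tau> within T)"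
    "((\<lambda>\<tau>. De (p + \<tau> *\<^sub>R b) b + A * (fst p + \<tau> * fst b - c) * fst b + B * fst b) has_real_derivative
        D2e (p + \<tau> *\<^sub>R b) b b + A * (fst b)\<^sup>2) (at \<tau> within T)"
    if "\<And>\<tau>. \<tau> \<in> T \<Longrightarrow> p + \<tau> *\<^sub>R b \<in> halfball z \<rho>" "\<tau> \<in> T" for p b \<tau> T
    unfolding v_def
    by (rule derivative_eq_intros C2_line_derivs[OF C2 that] refl | simp add: power2_eq_square algebra_simps)+
  \<comment> \<open>\<open>D2e\<close> is continuous only on the half-ball, which need not be
    compact. The intermediate radius \<open>s'\<close> supplies a compact set for uniform continuity
    and room for shifts of length \<open>t < s' - s\<close>.\<close>
  define K where "K = cball z s' \<inter> halfspace"
  have K_sub: "K \<subseteq> halfball z \<rho>" using s by (auto simp: K_def halfball_def)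
  have "uniformly_continuous_on K D2e"
    using C2 K_sub unfolding C2_with_derivs_def K_def
    by (intro compact_uniformly_continuous compact_Int_closed closed_halfspace compact_cball)
       (auto intro: continuous_on_subset)
  then obtain d where d: "0 < d" "\<And>p q. p \<in> K \<Longrightarrow> q \<in> K \<Longrightarrow> dist q p < d \<Longrightarrow> dist (D2e q) (D2e p) < \<epsilon> / N"
    unfolding uniformly_continuous_on_def using \<epsilon> N by (metis divide_pos_pos)
  define \<delta> where "\<delta> = min d (s' - s)"
  have "0 < \<delta>" using d s by (simp add: \<delta>_def)
  moreover have "(\<Sum>b\<in>Basis. W (x + t *\<^sub>R b) + W (x - t *\<^sub>R b) - 2 * W x) \<ge> - \<epsilon> * t\<^sup>2"
    if t: "0 < t" "t < \<delta>" and x: "x \<in> cball z s" for t x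
  proof -
    define x' where "x' = halfspace_fold x"
    have x': "x' \<in> cball z s" "x' \<in> halfspace"
      using dist_halfspace_fold_le[OF z, of x] x by (auto simp: x'_def)
    have "dist z q \<le> s + t" if "dist x' q \<le> t" for q
      using dist_triangle[of z q x'] x' that by simp
    then have K: "q \<in> K" if "dist x' q \<le> t" "fst q \<ge> 0" for q
      using that t by (fastforce simp: K_def halfspace_def \<delta>_def)
    have Wv: "W (x + \<tau> *\<^sub>R b) = v (halfspace_fold (x + \<tau> *\<^sub>R b))" if "\<bar>\<tau>\<bar> \<le> t" "b \<in> Basis" for \<tau> b
    proof -
      have "dist z (x + \<tau> *\<^sub>R b) \<le> dist z x + \<bar>\<tau>\<bar>"
        using dist_triangle[of z "x + \<tau> *\<^sub>R b" x] that by (simp add: dist_norm)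
      then show ?thesis using that t x by (subst W) (auto simp: v_def \<delta>_def)
    qed
    have near: "D2e q b b \<ge> D2e x' b b - \<epsilon> / N" if "dist x' q \<le> t" "fst q \<ge> 0" "b \<in> Basis" for q b
    proof -
      have "\<bar>D2e q b b - D2e x' b b\<bar> = norm ((D2e q - D2e x') b b)" by (simp add: blinfun.diff_left)
      also have "\<dots> \<le> norm ((D2e q - D2e x') b) * norm b" by (rule norm_blinfun)
      also have "\<dots> \<le> norm (D2e q - D2e x') * norm b * norm b"
        by (intro mult_right_mono norm_blinfun) auto
      also have "\<dots> < \<epsilon> / N"
        using d(2)[of x' q] K[of q] K[of x'] that t x' by (simp add: dist_norm norm_minus_commute \<delta>_def halfspace_def)
      finally show ?thesis by (simp add: abs_less_iff)
    qed
    have key: "W (x + t *\<^sub>R b) + W (x - t *\<^sub>R b) - 2 * W x \<ge> (D2e x' b b + A * (fst b)\<^sup>2 - \<epsilon> / N) * t\<^sup>2"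
      if b: "b \<in> Basis" for b
    proof -
      have W3: "W (x + t *\<^sub>R b) + W (x - t *\<^sub>R b) - 2 * W x
          = v (halfspace_fold (x + t *\<^sub>R b)) + v (halfspace_fold (x - t *\<^sub>R b)) - 2 * v x'"
        using Wv[of t b] Wv[of "-t" b] Wv[of 0 b] b t by (simp add: x'_def)
      have interior: "v (x' + t *\<^sub>R b) + v (x' - t *\<^sub>R b) - 2 * v x' \<ge> (D2e x' b b + A * (fst b)\<^sup>2 - \<epsilon> / N) * t\<^sup>2"
        if pos: "\<And>\<tau>. \<tau> \<in> {-t..t} \<Longrightarrow> fst (x' + \<tau> *\<^sub>R b) \<ge> 0"
      proof -
        have dist: "dist x' (x' + \<tau> *\<^sub>R b) \<le> t" if "\<tau> \<in> {-t..t}" for \<tau>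
          using that b by (auto simp: dist_norm)
        have inD: "x' + \<tau> *\<^sub>R b \<in> halfball z \<rho>" if "\<tau> \<in> {-t..t}" for \<tau>
          using K[OF dist pos] K_sub that by blast
        have "v (x' + (0+t) *\<^sub>R b) + v (x' + (0-t) *\<^sub>R b) - 2 * v (x' + 0 *\<^sub>R b)
            \<ge> (D2e x' b b + A * (fst b)\<^sup>2 - \<epsilon> / N) * t\<^sup>2"
          by (rule second_difference_ge[OF t(1), of 0, OF line])
             (use near[OF dist pos b] in \<open>force simp: inD\<close>)+
        then show ?thesis by simp
      qed
      show ?thesis
      proof (cases "b = (1, 0)")
        \<comment> \<open>In a tangential direction the fold commutes with the shift, so the segment
          stays in the half-space.\<close>
        case False
        then have fb: "fst b = 0" using b by (auto simp: Basis_prod_def)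
        then have "halfspace_fold (x + t *\<^sub>R b) = x' + t *\<^sub>R b" "halfspace_fold (x - t *\<^sub>R b) = x' - t *\<^sub>R b"
          by (auto simp: halfspace_fold_def x'_def prod_eq_iff)
        then show ?thesis unfolding W3 using interior x' fb by (simp add: halfspace_def)
      next
        case True
        define x0 where "x0 = fst x'"
        have x0: "0 \<le> x0" using x' by (simp add: x0_def halfspace_def)
        \<comment> \<open>Folding maps the two shifted points to heights \<open>x0 + t\<close> and
          \<open>|x0 - t|\<close>; the sign of \<open>fst x\<close> only decides which is
          which.\<close>
        have fold: "v (halfspace_fold (x + t *\<^sub>R b)) + v (halfspace_fold (x - t *\<^sub>R b))
            = v (x0 + t, snd x') + v (\<bar>x0 - t\<bar>, snd x')"
        proof (cases "fst x \<ge> 0")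
          case True
          then have "\<bar>fst x + t\<bar> = x0 + t" "\<bar>fst x - t\<bar> = \<bar>x0 - t\<bar>"
            using t by (auto simp: x0_def x'_def halfspace_fold_def)
          then show ?thesis by (simp add: \<open>b = (1, 0)\<close> halfspace_fold_def x'_def)
        next
          case False
          then have "\<bar>fst x + t\<bar> = \<bar>x0 - t\<bar>" "\<bar>fst x - t\<bar> = x0 + t"
            using t by (auto simp: x0_def x'_def halfspace_fold_def)
          then show ?thesis by (simp add: \<open>b = (1, 0)\<close> halfspace_fold_def x'_def)
        qed
        show ?thesis
        proof (cases "t \<le> x0")
          case le: True
          then have "v (x0 + t, snd x') + v (\<bar>x0 - t\<bar>, snd x') = v (x' + t *\<^sub>R b) + v (x' - t *\<^sub>R b)"
            by (simp add: True x0_def prod_eq_iff plus_prod_def minus_prod_def)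
          then show ?thesis unfolding W3 fold using interior le x0 by (simp add: True x0_def)
        next
          case False
          \<comment> \<open>The shift crosses the boundary, so the normal line is parametrised by
            height from its foot \<open>p\<close> and the even-extension estimate is used.\<close>
          define p where "p = (0::real, snd x')"
          have pt: "p + \<tau> *\<^sub>R b = (\<tau>, snd x')" for \<tau> by (simp add: p_def True)
          have dist: "dist x' (p + \<tau> *\<^sub>R b) \<le> t" if "\<tau> \<in> {0..x0+t}" for \<tau>
            using that False by (auto simp: pt dist_prod_def dist_real_def x0_def)
          have pos: "fst (p + \<tau> *\<^sub>R b) \<ge> 0" if "\<tau> \<in> {0..x0+t}" for \<tau> using that by (simp add: pt)
          have inD: "p + \<tau> *\<^sub>R b \<in> halfball z \<rho>" if "\<tau> \<in> {0..x0+t}" for \<tau>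
            using K[OF dist pos] K_sub that by blast
          have pD: "p \<in> halfball z \<rho>" using inD[of 0] x0 t by simp
          have "\<bar>fst z - fst p\<bar> \<le> dist z p" using dist_fst_le[of z p] by (simp add: dist_real_def)
          then have "fst z < \<rho>" using pD by (auto simp: p_def halfball_def)
          then have "c = 0" by (simp add: c)
          \<comment> \<open>Since \<open>fst p\<close> and \<open>c\<close> are both 0, this is
            \<open>B\<close> minus the outer normal derivative at \<open>p\<close>. It is the slope
            condition for a convex kink.\<close>
          then have "0 \<le> De (p + 0 *\<^sub>R b) b + A * (fst p + 0 * fst b - c) * fst b + B * fst b"
            using nor[OF pD] by (simp add: p_def True outer_normal_deriv_def)
          then have "v (p + (x0+t) *\<^sub>R b) + v (p + (t-x0) *\<^sub>R b) - 2 * v (p + x0 *\<^sub>R b)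
              \<ge> (D2e x' b b + A * (fst b)\<^sup>2 - \<epsilon> / N) * t\<^sup>2"
            by (intro second_difference_even_extension_ge[OF x0, of t, OF _ line])
               (use near[OF dist pos b] False in \<open>force simp: inD\<close>)+
          moreover have "(x0, snd x') = x'" by (simp add: x0_def)
          ultimately show ?thesis unfolding W3 fold using False by (simp add: pt abs_if)
        qed
      qed
    qed
    have x'D: "x' \<in> halfball z \<rho>" using x' s by (auto simp: halfball_def)
    have "- \<epsilon> * t\<^sup>2 \<le> (- pos_laplacian D2e x' + A - \<epsilon>) * t\<^sup>2"
      using lap[OF x'D] by (intro mult_right_mono) auto
    \<comment> \<open>The quadratic correction contributes \<open>A\<close> once, from the direction
      \<open>(1, 0)\<close>; the error \<open>\<epsilon>\<close> is shared among the
      \<open>N\<close> directions.\<close>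
    also have "- pos_laplacian D2e x' + A - \<epsilon> = (\<Sum>b\<in>Basis. D2e x' b b + A * (fst b)\<^sup>2 - \<epsilon> / N)"
    proof -
      have "(\<Sum>b\<in>(Basis :: (real \<times> (real^'m)) set). (fst b)\<^sup>2) = 1"
        by (subst Basis_prod_def, subst sum.union_disjoint) (auto simp: sum.reindex inj_on_def)
      then show ?thesis using N
        by (simp add: pos_laplacian_def sum_subtractf sum.distrib N_def flip: sum_distrib_left del: DIM_prod)
    qed
    also have "\<dots> * t\<^sup>2 = (\<Sum>b\<in>Basis. (D2e x' b b + A * (fst b)\<^sup>2 - \<epsilon> / N) * t\<^sup>2)"
      by (rule sum_distrib_right)
    also have "\<dots> \<le> (\<Sum>b\<in>Basis. W (x + t *\<^sub>R b) + W (x - t *\<^sub>R b) - 2 * W x)"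
      by (rule sum_mono) (rule key)
    finally show ?thesis .
  qed
  ultimately show "\<exists>\<delta>>0. \<forall>t. 0 < t \<longrightarrow> t < \<delta> \<longrightarrow> (\<forall>x\<in>cball z s.
      - \<epsilon> * t\<^sup>2 \<le> (\<Sum>b\<in>Basis. W (x + t *\<^sub>R b) + W (x - t *\<^sub>R b) - 2 * W x))" by blast
qed

section \<open>Reflection invariance and the mean value inequality on half-balls\<close>

text \<open>The reflection is a diagonal linear map whose entries have absolute value 1.\<close>

lemma lborel_distr_reflect_fst:
  "distr lborel borel (\<lambda>x::real \<times> (real^'m). (- fst x, snd x)) = lborel"
proof -
  define c :: "real \<times> (real^'m) \<Rightarrow> real" where "c j = (if j = (1, 0) then - 1 else 1)" for j
  have "(0 + (\<Sum>j\<in>Basis. (c j * (x \<bullet> j)) *\<^sub>R j)) = (- fst x, snd x)" for x :: "real \<times> (real^'m)"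
  proof -
    have "c j * (x \<bullet> j) = (- fst x, snd x) \<bullet> j" if "j \<in> Basis" for j
      using that by (auto simp: c_def Basis_prod_def inner_prod_def)
    then show ?thesis using euclidean_representation[of "(- fst x, snd x)"] by simp
  qed
  moreover have "(\<Prod>j\<in>Basis. \<bar>c j\<bar>) = 1" by (intro prod.neutral) (auto simp: c_def)
  moreover have "lborel = density (distr lborel borel (\<lambda>x. 0 + (\<Sum>j\<in>Basis. (c j * (x \<bullet> j)) *\<^sub>R j)))
      (\<lambda>_. ennreal (\<Prod>j\<in>Basis. \<bar>c j\<bar>))"
    by (rule lborel_affine_euclidean) (auto simp: c_def)
  ultimately show ?thesis by (simp add: density_1)
qed

lemma lborel_integral_reflect_fst:
  fixes f :: "real \<times> (real^'m) \<Rightarrow> real"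
  assumes "integrable lborel f"
  shows "integrable lborel (\<lambda>x. f (- fst x, snd x))"
    and "(\<integral>x. f (- fst x, snd x) \<partial>lborel) = (\<integral>x. f x \<partial>lborel)"
proof -
  have [measurable]: "f \<in> borel_measurable borel" using borel_measurable_integrable[OF assms] by simp
  have [measurable]: "(\<lambda>x::real \<times> (real^'m). (- fst x, snd x)) \<in> borel_measurable borel"
    by (intro borel_measurable_continuous_onI continuous_intros)
  show "integrable lborel (\<lambda>x. f (- fst x, snd x))"
    using assms by (subst (asm) lborel_distr_reflect_fst[symmetric]) (simp add: integrable_distr_eq)
  show "(\<integral>x. f (- fst x, snd x) \<partial>lborel) = (\<integral>x. f x \<partial>lborel)"
    by (subst (2) lborel_distr_reflect_fst[symmetric]) (simp add: integral_distr)
qed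

text \<open>The kernel mean value inequality is applied to the corrected, folded function. The set
  \<open>S\<close> may exceed the half-ball, so that the integral over the original large half-ball
  can be inserted.\<close>

lemma halfball_mean_value:
  fixes z :: "real \<times> (real^'m)" and e :: "real \<times> (real^'m) \<Rightarrow> real"
  defines "n \<equiv> CARD('m) + 1"
  assumes z: "z \<in> halfspace" and \<rho>: "0 < \<rho>" and AB: "0 \<le> A" "0 \<le> B"
    and C2: "C2_with_derivs (halfball z \<rho>) e De D2e"
    and lap: "\<And>x. x \<in> halfball z \<rho> \<Longrightarrow> pos_laplacian D2e x \<le> A"
    and nor: "\<And>x. x \<in> halfball z \<rho> \<Longrightarrow> fst x = 0 \<Longrightarrow> outer_normal_deriv De x \<le> B"
    and S: "halfball z \<rho> \<subseteq> S" "e integrable_on S" "\<And>x. x \<in> S \<Longrightarrow> 0 \<le> e x"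
  shows "e z \<le> 2 * A * \<rho>\<^sup>2 + 2 * B * \<rho>
    + 2 ^ (n + 1) / bump_mass TYPE(real \<times> (real^'m)) / \<rho> ^ n * integral S e"
proof -
  define s s' where "s = \<rho> / 2" and "s' = 3 * \<rho> / 4"
  have s: "0 < s" "s < s'" "s' < \<rho>" using \<rho> by (auto simp: s_def s'_def)
  define c where "c = max 0 (fst z - \<rho>)"
  define h where "h x = A / 2 * (fst x - c)\<^sup>2 + B * (fst x - c)" for x :: "real \<times> (real^'m)"
  \<comment> \<open>The mean value lemma wants a function continuous on the whole space. Projecting
    to \<open>cball z s'\<close> before folding extends \<open>e\<close> and \<open>h\<close>
    without changing them on that ball.\<close>
  define P where "P x = halfspace_fold (closest_point (cball z s') x)" for x
  define M where "M = 2 * A * \<rho>\<^sup>2 + 2 * B * \<rho>"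
  define K where "K = bump_mass TYPE(real \<times> (real^'m))"
  have K: "0 < K" unfolding K_def by (rule bump_mass_pos)
  have closest: "closest_point (cball z s') x \<in> cball z s'" for x
    by (rule closest_point_in_set) (use s in auto)
  have P_cont: "continuous_on UNIV P"
    unfolding P_def
    by (rule continuous_on_compose2[OF continuous_on_halfspace_fold continuous_on_closest_point, of "cball z s'" UNIV UNIV])
       (use s in auto)
  have P_in: "P x \<in> cball z s' \<inter> halfspace" for x
    using closest[of x] dist_halfspace_fold_le[OF z, of "closest_point (cball z s') x"] by (auto simp: P_def)
  have P_in': "P x \<in> halfball z \<rho>" for x using s P_in[of x] by (auto simp: halfball_def)
  have P_eq: "P x = halfspace_fold x" if "x \<in> cball z s'" for x
    using that by (simp add: P_def closest_point_self)
  have e_cont: "continuous_on (halfball z \<rho>) e" by (rule C2_with_derivs_continuous[OF C2])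
  have E_cont: "continuous_on UNIV (\<lambda>x. e (P x))"
    by (rule continuous_on_compose2[OF e_cont P_cont]) (use P_in' in auto)
  have h_cont: "continuous_on UNIV (\<lambda>x. h (P x))"
    unfolding h_def by (intro continuous_intros P_cont)
  have h_bounds: "0 \<le> h x" "h x \<le> M" if "x \<in> halfball z \<rho>" for x
  proof -
    have "\<bar>fst z - fst x\<bar> < \<rho>" using dist_fst_le[of z x] that by (auto simp: halfball_def dist_real_def)
    moreover have "0 \<le> fst x" using that by (simp add: halfball_def halfspace_def)
    ultimately have b: "0 \<le> fst x - c" "fst x - c \<le> 2 * \<rho>" using \<rho> by (auto simp: c_def)
    have "h x \<le> A / 2 * (2 * \<rho>)\<^sup>2 + B * (2 * \<rho>)"
      unfolding h_def using b AB by (intro add_mono mult_left_mono power_mono) auto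
    then show "h x \<le> M" by (simp add: M_def)
    show "0 \<le> h x" using b AB by (simp add: h_def)
  qed
  have e_nn: "0 \<le> e (P x)" for x using S P_in'[of x] by blast
  have zP: "P z = z" using P_eq[of z] s z by (simp add: halfspace_fold_id)
  have zD: "z \<in> halfball z \<rho>" using z \<rho> by (simp add: halfball_def)

  have "almost_subharmonic_on (cball z s) (\<lambda>x. e (P x) + h (P x))"
    by (rule folded_almost_subharmonic[OF z s(2,3) AB C2 lap nor c_def]) (auto simp: P_eq h_def)
  then have "(e (P z) + h (P z)) * K \<le> (\<integral>x. (e (P x) + h (P x)) * bump_kernel z s x \<partial>lborel)"
    unfolding K_def by (intro almost_subharmonic_mean_value s continuous_intros E_cont h_cont)
  also have "\<dots> = (\<integral>x. e (P x) * bump_kernel z s x + h (P x) * bump_kernel z s x \<partial>lborel)"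
    by (simp add: algebra_simps)
  also have "\<dots> = (\<integral>x. e (P x) * bump_kernel z s x \<partial>lborel) + (\<integral>x. h (P x) * bump_kernel z s x \<partial>lborel)"
    by (intro Bochner_Integration.integral_add integrable_bump_kernel E_cont h_cont) (use s in auto)
  finally have "(e (P z) + h (P z)) * K
    \<le> (\<integral>x. e (P x) * bump_kernel z s x \<partial>lborel) + (\<integral>x. h (P x) * bump_kernel z s x \<partial>lborel)" .
  moreover have "e z * K \<le> (e (P z) + h (P z)) * K"
    using h_bounds(1)[OF zD] K by (intro mult_right_mono) (auto simp: zP)
  ultimately have 1: "e z * K \<le> (\<integral>x. e (P x) * bump_kernel z s x \<partial>lborel) + (\<integral>x. h (P x) * bump_kernel z s x \<partial>lborel)"
    by linarith

  have "(\<integral>x. h (P x) * bump_kernel z s x \<partial>lborel) \<le> (\<integral>x. M * bump_kernel z s x \<partial>lborel)"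
    using s P_in' by (intro integral_mono integrable_bump_kernel h_cont mult_right_mono h_bounds bump_kernel_nonneg) auto
  also have "\<dots> = M * K" using s by (simp add: integral_bump_kernel K_def)
  finally have 2: "(\<integral>x. h (P x) * bump_kernel z s x \<partial>lborel) \<le> M * K" .

  define D where "D = cball z s \<inter> halfspace"
  define G where "G x = indicator D x *\<^sub>R e x" for x
  have D_sub: "D \<subseteq> halfball z \<rho>" using s by (auto simp: D_def halfball_def)
  have G_int: "integrable lborel G"
    unfolding G_def
    by (rule borel_integrable_compact)
       (use D_sub in \<open>auto simp: D_def intro!: compact_Int_closed closed_halfspace continuous_on_subset[OF e_cont]\<close>)
  have "0 \<le> e x" if "x \<in> D" for x using S D_sub that by blast
  then have G_nn: "0 \<le> G x" for x by (simp add: G_def indicator_def)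
  have G_le: "(\<integral>x. G x \<partial>lborel) \<le> integral S e"
  proof -
    have "(G has_integral (\<integral>x. G x \<partial>lborel)) UNIV" by (rule has_integral_integral_lborel[OF G_int])
    moreover have "G = (\<lambda>x. if x \<in> D then e x else 0)" by (auto simp: G_def fun_eq_iff)
    ultimately have "(e has_integral (\<integral>x. G x \<partial>lborel)) D" by (simp add: has_integral_restrict_UNIV)
    then show ?thesis using D_sub S
      by (intro has_integral_subset_le[of D S e, OF _ _ integrable_integral]) auto
  qed
  \<comment> \<open>The kernel is at most \<open>1 / s ^ n\<close>. Each folded value is counted by
    \<open>G\<close> at \<open>x\<close> or at its mirror image, and both copies have the same
    integral, hence the factor 2.\<close>
  have "(\<integral>x. e (P x) * bump_kernel z s x \<partial>lborel) \<le> (\<integral>x. 1 / s ^ n * (G x + G (- fst x, snd x)) \<partial>lborel)"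
  proof (rule integral_mono)
    show "integrable lborel (\<lambda>x. e (P x) * bump_kernel z s x)"
      using s by (intro integrable_bump_kernel E_cont) auto
    show "integrable lborel (\<lambda>x. 1 / s ^ n * (G x + G (- fst x, snd x)))"
      using G_int lborel_integral_reflect_fst(1)[OF G_int] by simp
    show "e (P x) * bump_kernel z s x \<le> 1 / s ^ n * (G x + G (- fst x, snd x))" for x
    proof (cases "x \<in> cball z s")
      case True
      have D: "halfspace_fold x \<in> D"
        using True dist_halfspace_fold_le[OF z, of x] by (simp add: D_def)
      then have "e (P x) = G (halfspace_fold x)" using True s by (simp add: P_eq G_def)
      also have "\<dots> \<le> G x + G (- fst x, snd x)"
        using G_nn[of x] G_nn[of "(- fst x, snd x)"] by (auto simp: halfspace_fold_def abs_if)
      finally have *: "e (P x) \<le> G x + G (- fst x, snd x)" .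
      have "e (P x) * bump_kernel z s x \<le> (G x + G (- fst x, snd x)) * (1 / s ^ n)"
        using bump_kernel_le[OF s(1), of z x] * e_nn[of x] bump_kernel_nonneg[of s z x] s(1)
        by (intro mult_mono) (auto simp: n_def)
      then show ?thesis by (simp add: mult.commute)
    next
      case False
      then show ?thesis using s G_nn by (simp add: bump_kernel_outside)
    qed
  qed
  also have "\<dots> = 2 / s ^ n * (\<integral>x. G x \<partial>lborel)"
    using G_int lborel_integral_reflect_fst[OF G_int] by simp
  also have "\<dots> \<le> 2 / s ^ n * integral S e"
    using G_le s by (intro mult_left_mono) auto
  finally have 3: "(\<integral>x. e (P x) * bump_kernel z s x \<partial>lborel) \<le> 2 / s ^ n * integral S e" .
  from 1 2 3 have "e z * K \<le> M * K + 2 / s ^ n * integral S e" by linarith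
  then have "e z \<le> (M * K + 2 / s ^ n * integral S e) / K" using K by (simp add: pos_le_divide_eq)
  also have "\<dots> = M + 2 ^ (n + 1) / K / \<rho> ^ n * integral S e"
    using K \<rho> by (simp add: s_def field_simps)
  finally show ?thesis by (simp add: M_def K_def)
qed

section \<open>The Heinz trick\<close>

lemma sqrt_power_eq_powr:
  assumes "0 \<le> x" "0 < n"
  shows "sqrt x ^ n = x powr (real n / 2)"
proof (cases "x = 0")
  case False
  then have "sqrt x ^ n = (x powr (1/2)) powr real n"
    using assms by (simp add: powr_half_sqrt powr_realpow)
  then show ?thesis by (simp add: powr_powr)
qed (use assms in simp)

lemma powr_power_quotient:
  assumes "0 < u" "0 < n"
  shows "(u ^ n) powr ((real n + real k) / real n) = u ^ (n + k)"
proof -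
  have "(u ^ n) powr ((real n + real k) / real n) = u powr (real n * ((real n + real k) / real n))"
    using assms(1) by (simp add: powr_powr flip: powr_realpow)
  also have "\<dots> = u powr real (n + k)" using assms(2) by simp
  also have "\<dots> = u ^ (n + k)" using assms(1) by (rule powr_realpow)
  finally show ?thesis .
qed

text \<open>A suitable \<open>\<rho>\<close> bounds each of the four terms containing
  \<open>c\<close> by \<open>c / 8\<close>, together \<open>c / 2\<close>. The bound on
  \<open>I\<close> absorbs another \<open>c / 4\<close>, and the remaining quarter explains the
  factor \<open>4 * C0\<close>. Only \<open>k2\<close> depends on \<open>a\<close> and
  \<open>b\<close>.\<close>

lemma absorb_nonlinear_terms:
  fixes n :: nat and C0 a b c \<sigma> I A0 A1 B0 B1 :: real
  defines "k1 \<equiv> 1 / (8 * C0 * 2 ^ n)"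
    and "k2 \<equiv> 1 / (8 * C0 * 2 ^ (n + 2) * (1 + a + b))"
  assumes n: "0 < n" and C0: "1 \<le> C0" and ab: "0 \<le> a" "0 \<le> b" and c: "0 < c" and \<sigma>: "0 < \<sigma>"
    and AB: "0 \<le> A0" "0 \<le> A1" "0 \<le> B0" "0 \<le> B1" and I: "0 \<le> I" "I \<le> k2 ^ n / (4 * C0)"
    and bound: "\<And>\<rho>. 0 < \<rho> \<Longrightarrow> \<rho> \<le> \<sigma> \<Longrightarrow> c \<le> C0 *
      ((A0 + A1 * (2 ^ n * c) + a * (2 ^ n * c) powr ((real n + 2) / real n)) * \<rho>\<^sup>2
       + (B0 + B1 * (2 ^ n * c) + b * (2 ^ n * c) powr ((real n + 1) / real n)) * \<rho> + I / \<rho> ^ n)"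
  shows "c \<le> 4 * C0 * (A0 * \<sigma>\<^sup>2 + B0 * \<sigma>) + 4 * C0 * I * (1 / \<sigma> ^ n + (A1 powr (real n / 2) + B1 ^ n) / k1 ^ n)"
proof -
  \<comment> \<open>In terms of \<open>w\<close> the critical powers of \<open>2 ^ n * c\<close> are
    multiples of \<open>c * w\<^sup>2\<close> and \<open>c * w\<close>, so \<open>w * \<rho>\<close>
    small suffices to absorb them.\<close>
  define w where "w = root n c"
  have w: "0 < w" "w ^ n = c" using c n by (simp_all add: w_def)
  have pow: "(2 ^ n * c) powr ((real n + 2) / real n) = 2 ^ (n + 2) * c * w\<^sup>2"
    "(2 ^ n * c) powr ((real n + 1) / real n) = 2 ^ (n + 1) * c * w"
    using powr_power_quotient[of "2 * w" n 2] powr_power_quotient[of "2 * w" n 1] w n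
    by (simp_all add: power_mult_distrib power_add algebra_simps power2_eq_square)
  have pos: "1 \<le> 8 * C0 * 2 ^ n" "1 \<le> 8 * C0 * 2 ^ (n + 2) * (1 + a + b)"
  proof -
    have *: "1 \<le> 8 * C0 * 2 ^ m" for m :: nat
      using mult_mono[of 1 "8 * C0" 1 "2 ^ m"] C0 by simp
    show "1 \<le> 8 * C0 * 2 ^ n" by (rule *)
    show "1 \<le> 8 * C0 * 2 ^ (n + 2) * (1 + a + b)"
      using mult_mono[OF *[of "n+2"], of 1 "1 + a + b"] ab C0 by simp
  qed
  have k: "0 < k1" "k1 \<le> 1" "0 < k2" "k2 \<le> 1"
    using pos unfolding k1_def k2_def by (auto simp: field_simps)
  have k1: "C0 * 2 ^ n * k1 = 1 / 8" using C0 by (simp add: k1_def)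
  have k2: "C0 * 2 ^ (n + 2) * a * k2 \<le> 1 / 8" "C0 * 2 ^ (n + 1) * b * k2 \<le> 1 / 8"
  proof -
    have "C0 * 2 ^ (n + 2) * k2 * (1 + a + b) = 1 / 8" using C0 ab by (simp add: k2_def)
    moreover have "0 \<le> C0 * 2 ^ (n + 2) * k2" using C0 k by simp
    ultimately have "C0 * 2 ^ (n + 2) * k2 * a \<le> 1 / 8" "C0 * 2 ^ (n + 2) * k2 * b \<le> 1 / 8"
      using ab by (metis mult_left_mono add_increasing add_increasing2 order_refl zero_le_one)+
    moreover have "C0 * 2 ^ (n + 1) * b * k2 \<le> C0 * 2 ^ (n + 2) * k2 * b" using C0 ab k by simp
    ultimately show "C0 * 2 ^ (n + 2) * a * k2 \<le> 1 / 8" "C0 * 2 ^ (n + 1) * b * k2 \<le> 1 / 8"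
      by (simp_all add: mult_ac)
  qed
  \<comment> \<open>\<open>1 / Q\<close> is the largest \<open>\<rho>\<close> with
    \<open>\<rho> \<le> \<sigma>\<close>, \<open>sqrt A1 * \<rho> \<le> k1\<close>,
    \<open>B1 * \<rho> \<le> k1\<close> and \<open>w * \<rho> \<le> k2\<close>. The cost
    \<open>I / \<rho> ^ n\<close> is then at most the sum of the four contributions.\<close>
  define Q where "Q = Max {1 / \<sigma>, sqrt A1 / k1, B1 / k1, w / k2}"
  have Q: "1 / \<sigma> \<le> Q" "sqrt A1 / k1 \<le> Q" "B1 / k1 \<le> Q" "w / k2 \<le> Q"
    unfolding Q_def by (rule Max_ge; simp)+
  have "0 < 1 / \<sigma>" using \<sigma> by simp
  then have Qpos: "0 < Q" using Q(1) by linarith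
  have "Q \<in> {1 / \<sigma>, sqrt A1 / k1, B1 / k1, w / k2}" unfolding Q_def by (rule Max_in) auto
  moreover have "0 \<le> (1 / \<sigma>) ^ n" "0 \<le> (sqrt A1 / k1) ^ n" "0 \<le> (B1 / k1) ^ n" "0 \<le> (w / k2) ^ n"
    using \<sigma> AB k w by simp_all
  ultimately have Qn: "Q ^ n \<le> (1 / \<sigma>) ^ n + (sqrt A1 / k1) ^ n + (B1 / k1) ^ n + (w / k2) ^ n"
    by auto
  define \<rho> where "\<rho> = 1 / Q"
  have \<rho>: "0 < \<rho>" "\<rho> \<le> \<sigma>"
    using Qpos Q(1) \<sigma> by (auto simp: \<rho>_def field_simps)
  have small: "sqrt A1 * \<rho> \<le> k1" "B1 * \<rho> \<le> k1" "w * \<rho> \<le> k2"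
    using Q Qpos k by (auto simp: \<rho>_def field_simps)
  have "(sqrt A1 * \<rho>)\<^sup>2 \<le> k1\<^sup>2" "(w * \<rho>)\<^sup>2 \<le> k2\<^sup>2"
    using small AB w \<rho> by (auto intro!: power_mono)
  \<comment> \<open>Since \<open>k1\<close> and \<open>k2\<close> are at most 1, their squares may
    be replaced by the numbers themselves.\<close>
  then have sq: "A1 * \<rho>\<^sup>2 \<le> k1" "w\<^sup>2 * \<rho>\<^sup>2 \<le> k2"
    using AB k power_decreasing[of 1 2 k1] power_decreasing[of 1 2 k2] by (auto simp: power_mult_distrib)
  have "C0 * 2 ^ n * (A1 * \<rho>\<^sup>2) * c \<le> C0 * 2 ^ n * k1 * c"
    using sq C0 c by (intro mult_left_mono mult_right_mono) auto
  also have "\<dots> = c / 8" unfolding k1 by simp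
  finally have t1: "C0 * (A1 * (2 ^ n * c)) * \<rho>\<^sup>2 \<le> c / 8" by (simp add: mult_ac)
  have "C0 * 2 ^ n * (B1 * \<rho>) * c \<le> C0 * 2 ^ n * k1 * c"
    using small C0 c by (intro mult_left_mono mult_right_mono) auto
  also have "\<dots> = c / 8" unfolding k1 by simp
  finally have t2: "C0 * (B1 * (2 ^ n * c)) * \<rho> \<le> c / 8" by (simp add: mult_ac)
  have "C0 * 2 ^ (n+2) * a * (w\<^sup>2 * \<rho>\<^sup>2) * c \<le> C0 * 2 ^ (n+2) * a * k2 * c"
    using sq C0 c ab by (intro mult_left_mono mult_right_mono) auto
  also have "\<dots> \<le> 1 / 8 * c" using k2 c by (intro mult_right_mono) auto
  finally have t3: "C0 * (a * (2 ^ (n + 2) * c * w\<^sup>2)) * \<rho>\<^sup>2 \<le> c / 8" by (simp add: mult_ac)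
  have "C0 * 2 ^ (n+1) * b * (w * \<rho>) * c \<le> C0 * 2 ^ (n+1) * b * k2 * c"
    using small C0 c ab by (intro mult_left_mono mult_right_mono) auto
  also have "\<dots> \<le> 1 / 8 * c" using k2 c by (intro mult_right_mono) auto
  finally have t4: "C0 * (b * (2 ^ (n + 1) * c * w)) * \<rho> \<le> c / 8" by (simp add: mult_ac)
  have "c \<le> C0 * (A0 * \<rho>\<^sup>2 + B0 * \<rho>) + C0 * (A1 * (2 ^ n * c)) * \<rho>\<^sup>2 + C0 * (B1 * (2 ^ n * c)) * \<rho>
      + C0 * (a * (2 ^ (n + 2) * c * w\<^sup>2)) * \<rho>\<^sup>2 + C0 * (b * (2 ^ (n + 1) * c * w)) * \<rho> + C0 * I * Q ^ n"
    using bound[OF \<rho>] unfolding pow by (simp add: algebra_simps \<rho>_def power_divide)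
  with t1 t2 t3 t4 have half: "c / 2 \<le> C0 * (A0 * \<rho>\<^sup>2 + B0 * \<rho>) + C0 * I * Q ^ n" by linarith
  \<comment> \<open>As \<open>w ^ n = c\<close>, this contribution is linear in \<open>c\<close>,
    and the smallness of \<open>I\<close> is calibrated to leave \<open>c / 4\<close>.\<close>
  have "(w / k2) ^ n * (C0 * I) \<le> (w / k2) ^ n * (C0 * (k2 ^ n / (4 * C0)))"
    using I C0 w k by (intro mult_left_mono) auto
  also have "\<dots> = c / 4" using C0 k w by (simp add: power_divide)
  finally have conc: "(w / k2) ^ n * (C0 * I) \<le> c / 4" .
  have "C0 * I * Q ^ n \<le> C0 * I * ((1 / \<sigma>) ^ n + (sqrt A1 / k1) ^ n + (B1 / k1) ^ n + (w / k2) ^ n)"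
    using Qn C0 I by (intro mult_left_mono) auto
  also have "\<dots> \<le> C0 * I * (1 / \<sigma> ^ n + (A1 powr (real n / 2) + B1 ^ n) / k1 ^ n) + c / 4"
    using conc by (simp add: power_divide sqrt_power_eq_powr[OF AB(2) n] algebra_simps add_divide_distrib)
  finally have C0I: "C0 * I * Q ^ n \<le> C0 * I * (1 / \<sigma> ^ n + (A1 powr (real n / 2) + B1 ^ n) / k1 ^ n) + c / 4" .
  have "C0 * (A0 * \<rho>\<^sup>2 + B0 * \<rho>) \<le> C0 * (A0 * \<sigma>\<^sup>2 + B0 * \<sigma>)"
    using \<rho> AB C0 by (intro mult_left_mono add_mono power_mono) auto
  with half C0I show ?thesis by linarith
qed

theorem theorem2p4:
  fixes dummy :: "real^'m"
  defines "n \<equiv> CARD('m) + 1"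
  shows "\<exists>C::real. \<forall>a b::real. a \<ge> 0 \<longrightarrow> b \<ge> 0 \<longrightarrow>
    (\<exists>\<mu>>0. \<forall>(y::real \<times> (real^'m)) (r::real) e De D2e (A0::real) A1 B0 B1.
       y \<in> halfspace \<longrightarrow> r > 0 \<longrightarrow>
       A0 \<ge> 0 \<longrightarrow> A1 \<ge> 0 \<longrightarrow> B0 \<ge> 0 \<longrightarrow> B1 \<ge> 0 \<longrightarrow>
       C2_with_derivs (halfball y r) e De D2e \<longrightarrow>
       (\<forall>x\<in>halfball y r. e x \<ge> 0) \<longrightarrow>
       (\<forall>x\<in>halfball y r.
          pos_laplacian D2e x \<le> A0 + A1 * e x + a * e x powr ((real n + 2) / real n)) \<longrightarrow>
       (\<forall>x\<in>halfball y r. fst x = 0 \<longrightarrow>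
          outer_normal_deriv De x \<le> B0 + B1 * e x + b * e x powr ((real n + 1) / real n)) \<longrightarrow>
       e integrable_on halfball y r \<longrightarrow>
       integral (halfball y r) e \<le> \<mu> \<longrightarrow>
       e y \<le> C * A0 * r\<^sup>2 + C * B0 * r
              + C * (A1 powr (real n / 2) + B1 ^ n + r powr (- real n)) * integral (halfball y r) e)"
proof -
  \<comment> \<open>The maximum dominates all three coefficients in
    \<open>halfball_mean_value\<close>. \<open>C\<close> below uses only \<open>C0\<close>,
    \<open>k1\<close> and \<open>n\<close>, so it is fixed before \<open>a\<close> and
    \<open>b\<close>.\<close>
  define C0 where "C0 = max 2 (2 ^ (n + 1) / bump_mass TYPE(real \<times> (real^'m)))"
  define k1 where "k1 = 1 / (8 * C0 * 2 ^ n)"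
  define C where "C = 4 * C0 * (4 ^ n + 1 / k1 ^ n)"
  have n: "0 < n" by (simp add: n_def)
  have C0: "1 \<le> C0" by (simp add: C0_def)
  have k1: "0 < k1" using C0 by (simp add: k1_def)
  have C: "4 * C0 \<le> C" "4 * C0 * 4 ^ n \<le> C" "4 * C0 / k1 ^ n \<le> C"
  proof -
    have "1 \<le> 4 ^ n + 1 / k1 ^ n" using k1 one_le_power[of 4 n] by (simp add: add_increasing2)
    then show "4 * C0 \<le> C" using C0 mult_left_mono[of 1 _ "4 * C0"] by (simp add: C_def)
    show "4 * C0 * 4 ^ n \<le> C" "4 * C0 / k1 ^ n \<le> C" using C0 k1 by (simp_all add: C_def distrib_left)
  qed
  show ?thesis
  proof (rule exI[of _ C], intro allI impI, goal_cases)
    case (1 a b)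
    note ab = 1
    define k2 where "k2 = 1 / (8 * C0 * 2 ^ (n + 2) * (1 + a + b))"
    have \<mu>: "0 < k2 ^ n / (4 * C0)" using C0 ab by (simp add: k2_def add_pos_nonneg)
    show ?case
    proof (intro exI[of _ "k2 ^ n / (4 * C0)"] conjI allI impI)
      show "0 < k2 ^ n / (4 * C0)" by (rule \<mu>)
    next
      fix y :: "real \<times> (real^'m)" and r :: real and e De D2e and A0 A1 B0 B1 :: real
      assume y: "y \<in> halfspace" and r: "0 < r" and AB: "0 \<le> A0" "0 \<le> A1" "0 \<le> B0" "0 \<le> B1"
        and C2: "C2_with_derivs (halfball y r) e De D2e"
        and nn: "\<forall>x\<in>halfball y r. e x \<ge> 0"
        and lap: "\<forall>x\<in>halfball y r.
          pos_laplacian D2e x \<le> A0 + A1 * e x + a * e x powr ((real n + 2) / real n)"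
        and nor: "\<forall>x\<in>halfball y r. fst x = 0 \<longrightarrow>
          outer_normal_deriv De x \<le> B0 + B1 * e x + b * e x powr ((real n + 1) / real n)"
        and int: "e integrable_on halfball y r"
        and small: "integral (halfball y r) e \<le> k2 ^ n / (4 * C0)"
      define I where "I = integral (halfball y r) e"
      have I: "0 \<le> I" unfolding I_def using int nn by (intro integral_nonneg) auto
      have rhs: "0 \<le> C * A0 * r\<^sup>2 + C * B0 * r + C * (A1 powr (real n / 2) + B1 ^ n + r powr (- real n)) * I"
        using C C0 AB I r by (intro add_nonneg_nonneg mult_nonneg_nonneg) auto
      have yD: "y \<in> halfball y r" using y r by (simp add: halfball_def)
      show "e y \<le> C * A0 * r\<^sup>2 + C * B0 * r
              + C * (A1 powr (real n / 2) + B1 ^ n + r powr (- real n)) * integral (halfball y r) e"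
      proof (cases "e y = 0")
        case True
        then show ?thesis using rhs by (simp add: I_def)
      next
        case False
        then have ey: "0 < e y" using nn yD by force
        \<comment> \<open>The smaller radius makes the closed half-ball a compact subset of the
          domain, so the weighted maximum is attained.\<close>
        define R where "R = r / 2"
        have R: "0 < R" "R < r" using r by (auto simp: R_def)
        define D where "D = cball y R \<inter> halfspace"
        define f where "f x = (R - dist y x) ^ n * e x" for x
        have D_sub: "D \<subseteq> halfball y r" using R by (auto simp: D_def halfball_def)
        have "compact D" unfolding D_def by (intro compact_Int_closed closed_halfspace compact_cball)
        moreover have "y \<in> D" using y R by (simp add: D_def)
        moreover have "continuous_on D f" unfolding f_def
          using continuous_on_subset[OF C2_with_derivs_continuous[OF C2] D_sub]
          by (intro continuous_intros)
        ultimately obtain z where z: "z \<in> D" "\<And>x. x \<in> D \<Longrightarrow> f x \<le> f z"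
          using continuous_attains_sup[of D f] by blast
        have fy: "R ^ n * e y \<le> f z" using z(2)[OF \<open>y \<in> D\<close>] by (simp add: f_def)
        have "0 < R ^ n * e y" using R ey by simp
        then have fz: "0 < f z" using fy by linarith
        \<comment> \<open>The weight vanishes on the sphere of radius \<open>R\<close> because
          \<open>0 < n\<close>, whereas \<open>f z\<close> is positive.\<close>
        have "R \<noteq> dist y z" using fz n by (auto simp: f_def zero_power)
        then have zR: "dist y z < R" using z(1) by (simp add: D_def)
        define \<sigma> where "\<sigma> = (R - dist y z) / 2"
        define c where "c = e z"
        have \<sigma>: "0 < \<sigma>" "2 * \<sigma> \<le> R" using zR by (auto simp: \<sigma>_def)
        have "R - dist y z = 2 * \<sigma>" by (simp add: \<sigma>_def)
        then have f_z: "f z = (2 * \<sigma>) ^ n * c" by (simp add: f_def c_def)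
        have c: "0 < c" using fz \<sigma> zero_less_mult_pos[of "(2 * \<sigma>) ^ n" c] by (simp add: f_z)
        have zH: "z \<in> halfspace" using z by (simp add: D_def)
        \<comment> \<open>Within \<open>\<sigma>\<close> of \<open>z\<close> the weight base
          \<open>R - dist y x\<close> is at least \<open>\<sigma>\<close>, and at \<open>z\<close>
          it is \<open>2 * \<sigma>\<close>; maximality therefore costs a factor
          \<open>2 ^ n\<close>.\<close>
        have near: "x \<in> D" "e x \<le> 2 ^ n * c" if "x \<in> halfball z \<sigma>" for x
        proof -
          have "dist y x \<le> dist y z + dist z x" by (rule dist_triangle)
          then have d: "\<sigma> \<le> R - dist y x" using that by (simp add: halfball_def \<sigma>_def)
          then show "x \<in> D" using that \<sigma> by (simp add: D_def halfball_def)
          then have "0 \<le> e x" using D_sub nn by blast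
          then have "\<sigma> ^ n * e x \<le> f x" unfolding f_def using d \<sigma> by (intro mult_right_mono power_mono) auto
          also have "\<dots> \<le> (2 * \<sigma>) ^ n * c" using z(2)[OF \<open>x \<in> D\<close>] by (simp add: f_z)
          also have "\<dots> = \<sigma> ^ n * (2 ^ n * c)" by (simp add: power_mult_distrib)
          finally show "e x \<le> 2 ^ n * c" using \<sigma> by simp
        qed
        define A where "A = A0 + A1 * (2 ^ n * c) + a * (2 ^ n * c) powr ((real n + 2) / real n)"
        define B where "B = B0 + B1 * (2 ^ n * c) + b * (2 ^ n * c) powr ((real n + 1) / real n)"
        have ABnn: "0 \<le> A" "0 \<le> B" using AB ab c by (simp_all add: A_def B_def)
        have "c \<le> C0 * (A * \<rho>\<^sup>2 + B * \<rho> + I / \<rho> ^ n)" if \<rho>: "0 < \<rho>" "\<rho> \<le> \<sigma>" for \<rho>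
        proof -
          have sub: "halfball z \<rho> \<subseteq> halfball z \<sigma>" using \<rho> by (auto simp: halfball_def)
          have in_r: "x \<in> halfball y r" if "x \<in> halfball z \<rho>" for x using near(1) that sub D_sub by blast
          have ex: "0 \<le> e x" "e x \<le> 2 ^ n * c" if "x \<in> halfball z \<rho>" for x
            using near(2)[OF subsetD[OF sub that]] in_r[OF that] nn by blast+
          have "e z \<le> 2 * A * \<rho>\<^sup>2 + 2 * B * \<rho>
              + 2 ^ (n + 1) / bump_mass TYPE(real \<times> (real^'m)) / \<rho> ^ n * I"
            unfolding n_def I_def
          proof (rule halfball_mean_value[OF zH \<rho>(1) ABnn])
            show "C2_with_derivs (halfball z \<rho>) e De D2e"
              by (rule C2_with_derivs_subset[OF C2]) (use in_r in blast)
            show "pos_laplacian D2e x \<le> A" if x: "x \<in> halfball z \<rho>" for x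
            proof -
              have "pos_laplacian D2e x \<le> A0 + A1 * e x + a * e x powr ((real n + 2) / real n)"
                using lap in_r[OF x] by blast
              also have "\<dots> \<le> A" unfolding A_def using ex[OF x] AB ab
                by (intro add_mono mult_left_mono powr_mono2) auto
              finally show ?thesis .
            qed
            show "outer_normal_deriv De x \<le> B" if x: "x \<in> halfball z \<rho>" "fst x = 0" for x
            proof -
              have "outer_normal_deriv De x \<le> B0 + B1 * e x + b * e x powr ((real n + 1) / real n)"
                using nor in_r[OF x(1)] x(2) by blast
              also have "\<dots> \<le> B" unfolding B_def using ex[OF x(1)] AB ab
                by (intro add_mono mult_left_mono powr_mono2) auto
              finally show ?thesis .
            qed
          qed (use in_r int nn in auto)
          also have "\<dots> \<le> C0 * (A * \<rho>\<^sup>2) + C0 * (B * \<rho>) + C0 * (I / \<rho> ^ n)"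
          proof -
            have "2 * (A * \<rho>\<^sup>2) \<le> C0 * (A * \<rho>\<^sup>2)" "2 * (B * \<rho>) \<le> C0 * (B * \<rho>)"
              "2 ^ (n + 1) / bump_mass TYPE(real \<times> (real^'m)) * (I / \<rho> ^ n) \<le> C0 * (I / \<rho> ^ n)"
              using ABnn \<rho> I by (intro mult_right_mono; simp add: C0_def)+
            then show ?thesis by simp
          qed
          finally show ?thesis by (simp add: c_def distrib_left)
        qed
        then have cb: "c \<le> 4 * C0 * (A0 * \<sigma>\<^sup>2 + B0 * \<sigma>)
            + 4 * C0 * I * (1 / \<sigma> ^ n + (A1 powr (real n / 2) + B1 ^ n) / k1 ^ n)"
          unfolding k1_def A_def B_def
          using small by (intro absorb_nonlinear_terms[OF n C0 ab c \<sigma>(1) AB I]) (auto simp: k2_def I_def)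
        \<comment> \<open>Maximality gives \<open>e y \<le> q * c\<close>. The factor
          \<open>q\<close> turns the uncontrolled \<open>1 / \<sigma> ^ n\<close> into
          \<open>(4 / r) ^ n\<close>, and \<open>q \<le> 1\<close> suffices for the other
          terms.\<close>
        define q where "q = (2 * \<sigma> / R) ^ n"
        have q: "0 \<le> q" "q \<le> 1" using \<sigma> R by (auto simp: q_def intro!: power_le_one)
        have q\<sigma>: "q * (1 / \<sigma> ^ n) = 4 ^ n * r powr (- real n)"
        proof -
          have "2 * \<sigma> / R * (1 / \<sigma>) = 4 / r" using \<sigma> r by (simp add: R_def)
          then have "q * (1 / \<sigma> ^ n) = (4 / r) ^ n"
            unfolding q_def by (metis power_mult_distrib power_one_over)
          then show ?thesis using r by (simp add: power_divide powr_minus powr_realpow divide_inverse power_inverse)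
        qed
        have "e y * R ^ n \<le> (2 * \<sigma>) ^ n * c" using fy by (simp add: f_z mult.commute)
        then have "e y \<le> (2 * \<sigma>) ^ n * c / R ^ n" using R by (simp add: pos_le_divide_eq)
        also have "\<dots> = q * c" by (simp add: q_def power_divide)
        finally have "e y \<le> q * c" .
        also have "\<dots> \<le> q * (4 * C0 * (A0 * \<sigma>\<^sup>2 + B0 * \<sigma>)
            + 4 * C0 * I * (1 / \<sigma> ^ n + (A1 powr (real n / 2) + B1 ^ n) / k1 ^ n))"
          using q cb by (intro mult_left_mono)
        also have "\<dots> = q * (4 * C0 * (A0 * \<sigma>\<^sup>2 + B0 * \<sigma>)) + 4 * C0 * I * (q * (1 / \<sigma> ^ n))
            + q * (4 * C0 * I * ((A1 powr (real n / 2) + B1 ^ n) / k1 ^ n))"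
          by (simp add: algebra_simps)
        also have "\<dots> \<le> 1 * (4 * C0 * (A0 * r\<^sup>2 + B0 * r)) + 4 * C0 * I * (4 ^ n * r powr (- real n))
            + 1 * (4 * C0 * I * ((A1 powr (real n / 2) + B1 ^ n) / k1 ^ n))"
          unfolding q\<sigma> using q \<sigma> R AB C0 I k1
          by (intro add_mono mult_mono power_mono order_refl mult_nonneg_nonneg add_nonneg_nonneg) auto
        also have "\<dots> = 4 * C0 * (A0 * r\<^sup>2 + B0 * r) + 4 * C0 * 4 ^ n * (r powr (- real n) * I)
            + 4 * C0 / k1 ^ n * ((A1 powr (real n / 2) + B1 ^ n) * I)"
          by (simp add: algebra_simps add_divide_distrib)
        also have "\<dots> \<le> C * (A0 * r\<^sup>2 + B0 * r) + C * (r powr (- real n) * I)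
            + C * ((A1 powr (real n / 2) + B1 ^ n) * I)"
          using AB r I C by (intro add_mono mult_right_mono) auto
        finally show ?thesis by (simp add: I_def algebra_simps)
      qed
    qed
  qed
qed

end
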